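(* Let $k\geq2$ be an integer and let $\mathcal{S}$ be a ring with $\mathbb{Q}\subseteq\mathcal{S}\subseteq\mathbb{A}$, where $\mathbb{A}$ is the set of real algebraic numbers. The decision problem "Given a $k$-regular sequence $(f(n))_{n\geq0}$ over $\mathcal{S}$, does $f(n)$ have at least polynomial growth, i.e., does there exist $\sigma>0$ such that $f(n)\notin O(n^\sigma)$?" is recursively unsolvable.
   Context: For $n\in\mathbb{N}_0$ let $(n)_k=n_{s-1}\cdots n_0$ be the standard base-$k$ representation of $n$ (no leading zeros; $(0)_k$ empty). A sequence $(f(n))_{n\geq0}$ over $\mathcal{S}$ is $k$-regular if there exist $r\geq0$, a $1\times r$ row vector $v$, an $r\times1$ column vector $w$ and $r\times r$ matrices $M_0,\dots,M_{k-1}$ with entries in $\mathcal{S}$ such that $f(n)=vM_{n_0}\cdots M_{n_{s-1}}w$ for all $n$. The input is such a linear representation; a real algebraic number is given by its minimal polynomial together with a rational interval containing it and none of its conjugates. $f(n)\in O(g(n))$ means there exist $n_0$, $c>0$ with $|f(n)|\leq c\,g(n)$ for all $n\geq n_0$. *)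

theory Defs
  imports Complex_Main "HOL-Computational_Algebra.Computational_Algebra"
    "HOL-Library.Nat_Bijection" "HOL-Library.Landau_Symbols"
begin

datatype recf = Zero | Succ | Proj nat | Comp recf "recf list" | Prim recf recf | Mu recf

inductive eval :: "recf \<Rightarrow> nat list \<Rightarrow> nat \<Rightarrow> bool" where
  eval_zero: "eval Zero xs 0"
| eval_succ: "eval Succ (x # xs) (Suc x)"
| eval_proj: "i < length xs \<Longrightarrow> eval (Proj i) xs (xs ! i)"
| eval_comp: "list_all2 (\<lambda>g y. eval g xs y) gs ys \<Longrightarrow> eval f ys z \<Longrightarrow> eval (Comp f gs) xs z"
| eval_prim0: "eval f xs y \<Longrightarrow> eval (Prim f g) (0 # xs) y"
| eval_primS: "eval (Prim f g) (n # xs) y \<Longrightarrow> eval g (y # n # xs) z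
     \<Longrightarrow> eval (Prim f g) (Suc n # xs) z"
| eval_mu: "eval f (n # xs) 0 \<Longrightarrow> (\<forall>m<n. \<exists>y. eval f (m # xs) y \<and> y > 0)
     \<Longrightarrow> eval (Mu f) xs n"

text \<open>A real algebraic number is represented by (coefficients of its minimal polynomial over Q,
  lowest degree first, lower end, upper end of a rational interval).\<close>
type_synonym algrep = "rat list \<times> rat \<times> rat"

definition alg_poly :: "algrep \<Rightarrow> rat poly" where
  "alg_poly a = Poly (fst a)"

definition alg_roots_in :: "algrep \<Rightarrow> real set" where
  "alg_roots_in a = {x. real_of_rat (fst (snd a)) \<le> x \<and> x \<le> real_of_rat (snd (snd a)) \<and>
                        poly (map_poly real_of_rat (alg_poly a)) x = 0}"

definition valid_alg :: "algrep \<Rightarrow> bool" where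
  "valid_alg a \<longleftrightarrow> lead_coeff (alg_poly a) = 1 \<and> irreducible (alg_poly a) \<and>
                   card (alg_roots_in a) = 1"

definition alg_val :: "algrep \<Rightarrow> real" where
  "alg_val a = (THE x. x \<in> alg_roots_in a)"

text \<open>A linear representation: (r, v, w, Ms) with Ms ! d ! i ! j the (i,j) entry of M_d.\<close>
type_synonym linrep = "nat \<times> algrep list \<times> algrep list \<times> algrep list list list"

definition valid_linrep :: "nat \<Rightarrow> real set \<Rightarrow> linrep \<Rightarrow> bool" where
  "valid_linrep k S L = (case L of (r, v, w, Ms) \<Rightarrow>
     length v = r \<and> length w = r \<and> length Ms = k \<and>
     (\<forall>M \<in> set Ms. length M = r \<and> (\<forall>row \<in> set M. length row = r)) \<and>
     (\<forall>a. (a \<in> set v \<or> a \<in> set w \<or> (\<exists>M\<in>set Ms. \<exists>row\<in>set M. a \<in> set row)) \<longrightarrow>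
          valid_alg a \<and> alg_val a \<in> S))"

fun digits :: "nat \<Rightarrow> nat \<Rightarrow> nat list" where
  "digits k n = (if n = 0 \<or> k < 2 then [] else n mod k # digits k (n div k))"

definition matmul :: "nat \<Rightarrow> (nat \<Rightarrow> nat \<Rightarrow> real) \<Rightarrow> (nat \<Rightarrow> nat \<Rightarrow> real) \<Rightarrow> nat \<Rightarrow> nat \<Rightarrow> real" where
  "matmul r A B = (\<lambda>i j. \<Sum>l<r. A i l * B l j)"

definition idmat :: "nat \<Rightarrow> nat \<Rightarrow> real" where
  "idmat = (\<lambda>i j. if i = j then 1 else 0)"

fun matprod :: "nat \<Rightarrow> (nat \<Rightarrow> nat \<Rightarrow> nat \<Rightarrow> real) \<Rightarrow> nat list \<Rightarrow> nat \<Rightarrow> nat \<Rightarrow> real" where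
  "matprod r M [] = idmat"
| "matprod r M (d # ds) = matmul r (M d) (matprod r M ds)"

definition linrep_seq :: "nat \<Rightarrow> linrep \<Rightarrow> nat \<Rightarrow> real" where
  "linrep_seq k L n = (case L of (r, v, w, Ms) \<Rightarrow>
     (let M = (\<lambda>d i j. alg_val (Ms ! d ! i ! j)); P = matprod r M (digits k n) in
      \<Sum>i<r. \<Sum>j<r. alg_val (v ! i) * P i j * alg_val (w ! j)))"

definition has_poly_growth :: "(nat \<Rightarrow> real) \<Rightarrow> bool" where
  "has_poly_growth f \<longleftrightarrow> (\<exists>\<sigma>>0. f \<notin> O(\<lambda>n. real n powr \<sigma>))"

definition enc_rat :: "rat \<Rightarrow> nat" where
  "enc_rat q = (case quotient_of q of (a, b) \<Rightarrow> prod_encode (int_encode a, int_encode b))"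

definition enc_alg :: "algrep \<Rightarrow> nat" where
  "enc_alg a = (case a of (p, l, u) \<Rightarrow>
     prod_encode (list_encode (map enc_rat p), prod_encode (enc_rat l, enc_rat u)))"

definition enc_linrep :: "linrep \<Rightarrow> nat" where
  "enc_linrep L = (case L of (r, v, w, Ms) \<Rightarrow>
     prod_encode (r, prod_encode (list_encode (map enc_alg v),
       prod_encode (list_encode (map enc_alg w),
         list_encode (map (\<lambda>M. list_encode (map (\<lambda>row. list_encode (map enc_alg row)) M)) Ms)))))"

definition is_subring :: "real set \<Rightarrow> bool" where
  "is_subring S \<longleftrightarrow> 0 \<in> S \<and> 1 \<in> S \<and> (\<forall>x\<in>S. \<forall>y\<in>S. x + y \<in> S \<and> x - y \<in> S \<and> x * y \<in> S)"

end

theory Submission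
  imports Defs
begin

text \<open>
  Evaluation of recursive functions can be carried out nondeterministically on a stack of goals:
  each step replaces the top goal by the premises of a rule of \<open>eval\<close>, guessing intermediate
  values. With pairing-coded stacks this is a number rewriting system with finitely many rules
  \<open>P(y) \<rightarrow> Q(y)\<close>, and by diagonalization it is undecidable whether \<open>c\<close> rewrites to \<open>0\<close>.

  A rewriting sequence is verified by integer registers under finitely many letters: \<open>Inc e\<close>
  counts up the guessed value of a subexpression \<open>e\<close>, and \<open>Fire P Q\<close> performs a rewriting step,
  adding to a penalty the squares of the (linear) equations that the guesses must satisfy. The
  penalty and the products of two registers evolve linearly, so the integer
  \<open>test u = 1 - penalty - config\<^sup>2\<close> attached to a word \<open>u\<close> of letters is given by integer
  matrices, and \<open>c\<close> rewrites to \<open>0\<close> iff \<open>test u > 0\<close> for some \<open>u\<close>.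

  Finally each letter is coded by a block of digits and a further block separates words, such that
  the sequence at \<open>u\<^sub>1#\<dots>#u\<^sub>m#\<close> is the product of the numbers
  \<open>1 + test u\<^sub>i / (N C\<^bsup>|u\<^sub>i| + 1\<^esup>)\<close>, where \<open>C\<close> and \<open>N\<close> are so large that \<open>test u \<le> 0\<close> yields a
  factor of modulus at most \<open>1\<close>. Hence the sequence is bounded if no \<open>test u\<close> is positive and
  grows polynomially otherwise. The start value \<open>c\<close> enters only through the entries
  \<open>0, 1, c, c\<^sup>2\<close> divided by \<open>N = (c + 1)\<^sup>2\<close>, which makes the reduction computable.
\<close>

section \<open>Recursive functions\<close>

inductive_cases eval_ZeroE: "eval Zero xs y"
inductive_cases eval_SuccE: "eval Succ xs y"
inductive_cases eval_ProjE: "eval (Proj i) xs y"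
inductive_cases eval_CompE: "eval (Comp f gs) xs y"
inductive_cases eval_PrimE: "eval (Prim f g) xs y"
inductive_cases eval_MuE: "eval (Mu f) xs y"

lemma eval_deterministic: "eval f xs y \<Longrightarrow> eval f xs z \<Longrightarrow> y = z"
proof (induction arbitrary: z rule: eval.induct)
  case (eval_comp xs gs ys f y)
  from eval_comp.prems obtain ys' where ys': "list_all2 (\<lambda>g y. eval g xs y) gs ys'" "eval f ys' z"
    by (auto elim: eval_CompE)
  have "ys = ys'"
    using eval_comp.IH(1) ys'(1) by (auto simp: list_all2_conv_all_nth list_eq_iff_nth_eq)
  then show ?case using eval_comp.IH ys' by blast
next
  case (eval_mu f n xs)
  from eval_mu.prems have z: "eval f (z # xs) 0" "\<forall>m<z. \<exists>y. eval f (m # xs) y \<and> y > 0"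
    by (auto elim: eval_MuE)
  \<comment> \<open>The smaller of two distinct minimizers would have the value 0 and also, lying
    below the other one, a positive value.\<close>
  show ?case
  proof (rule linorder_cases[of n z])
    assume "n < z" then show ?thesis using z(2) eval_mu.IH by blast
  next
    assume "z < n" then show ?thesis using z(1) eval_mu.IH by (metis less_irrefl)
  qed
next
  case (eval_prim0 f xs y g)
  from eval_prim0.prems have "eval f xs z" by (rule eval_PrimE) auto
  then show ?case by (rule eval_prim0.IH)
next
  case (eval_primS f g n xs y w)
  from eval_primS.prems obtain y' where "eval (Prim f g) (n # xs) y'" "eval g (y' # n # xs) z"
    by (rule eval_PrimE) auto
  then show ?case using eval_primS.IH by metis
qed (auto elim: eval_ZeroE eval_SuccE eval_ProjE)

section \<open>Closure properties of total recursive functions\<close>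

definition recursive :: "(nat \<Rightarrow> nat) \<Rightarrow> bool" where
  "recursive F \<longleftrightarrow> (\<exists>g. \<forall>n. eval g [n] (F n))"

definition recursive2 :: "(nat \<Rightarrow> nat \<Rightarrow> nat) \<Rightarrow> bool" where
  "recursive2 F \<longleftrightarrow> (\<exists>g. \<forall>m n. eval g [m, n] (F m n))"

lemma eval_Comp1: "eval g xs y \<Longrightarrow> eval f [y] z \<Longrightarrow> eval (Comp f [g]) xs z"
  by (rule eval_comp[of _ _ "[y]"]) auto

lemma eval_Comp2:
  "eval g xs y \<Longrightarrow> eval h xs y' \<Longrightarrow> eval f [y, y'] z \<Longrightarrow> eval (Comp f [g, h]) xs z"
  by (rule eval_comp[of _ _ "[y, y']"]) auto

lemma eval_Proj: "i < length xs \<Longrightarrow> xs ! i = y \<Longrightarrow> eval (Proj i) xs y"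
  using eval_proj by blast

lemma recursive_id: "recursive (\<lambda>n. n)"
  unfolding recursive_def by (rule exI[of _ "Proj 0"]) (simp add: eval_Proj)

lemma recursive_compose: "recursive F \<Longrightarrow> recursive G \<Longrightarrow> recursive (\<lambda>n. F (G n))"
  unfolding recursive_def using eval_Comp1 by blast

lemma recursive2_compose:
  "recursive2 F \<Longrightarrow> recursive G \<Longrightarrow> recursive H \<Longrightarrow> recursive (\<lambda>n. F (G n) (H n))"
  unfolding recursive_def recursive2_def using eval_Comp2 by blast

lemma recursive_Suc: "recursive Suc"
  unfolding recursive_def using eval_succ by blast

lemma recursive_const: "recursive (\<lambda>_. c)"
proof (induction c)
  case 0
  then show ?case unfolding recursive_def using eval_zero by blast
qed (rule recursive_compose[OF recursive_Suc])

lemma recursive_pred: "recursive (\<lambda>n. n - 1)"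
proof -
  have "eval (Prim Zero (Proj 1)) [n] (n - 1)" for n
    by (induction n) (auto intro!: eval_prim0 eval_zero eval_primS eval_Proj)
  then show ?thesis unfolding recursive_def by blast
qed

definition add_recf :: recf where
  "add_recf = Prim (Proj 0) (Comp Succ [Proj 0])"

lemma eval_add_recf: "eval add_recf [m, n] (m + n)"
proof (induction m)
  case (Suc m)
  show ?case unfolding add_recf_def
    by (auto intro!: eval_primS[OF Suc[unfolded add_recf_def]] eval_Comp1[OF eval_Proj eval_succ])
qed (auto simp: add_recf_def intro!: eval_prim0 eval_Proj)

lemma recursive_add: "recursive F \<Longrightarrow> recursive G \<Longrightarrow> recursive (\<lambda>n. F n + G n)"
  by (rule recursive2_compose) (use eval_add_recf in \<open>auto simp: recursive2_def\<close>)

lemma recursive_mult: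
  assumes "recursive F" "recursive G"
  shows "recursive (\<lambda>n. F n * G n)"
proof -
  have "eval (Prim Zero (Comp add_recf [Proj 2, Proj 0])) [m, n] (m * n)" for m n
  proof (induction m)
    case (Suc m)
    have "eval (Comp add_recf [Proj 2, Proj 0]) [m * n, m, n] (Suc m * n)"
      using eval_Comp2[OF eval_Proj eval_Proj eval_add_recf, of 2 "[m * n, m, n]" n 0 "m * n"]
      by simp
    then show ?case by (rule eval_primS[OF Suc])
  qed (auto intro: eval_prim0 eval_zero)
  then have "recursive2 (*)" unfolding recursive2_def by blast
  from recursive2_compose[OF this assms] show ?thesis .
qed

lemma recursive_triangle: "recursive triangle"
proof -
  let ?g = "Comp Succ [Comp add_recf [Proj 0, Proj 1]]"
  have "eval (Prim Zero ?g) [n] (triangle n)" for n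
  proof (induction n)
    case (Suc n)
    have "eval ?g [triangle n, n] (triangle (Suc n))"
      using eval_Comp1[OF eval_Comp2[OF eval_Proj eval_Proj eval_add_recf] eval_succ,
          of 0 "[triangle n, n]" "triangle n" 1 n] by simp
    then show ?case by (rule eval_primS[OF Suc])
  qed (auto intro: eval_prim0 eval_zero)
  then show ?thesis unfolding recursive_def by blast
qed

lemma recursive_prod_encode:
  "recursive F \<Longrightarrow> recursive G \<Longrightarrow> recursive (\<lambda>n. prod_encode (F n, G n))"
  unfolding prod_encode_def
  by (simp add: recursive_add recursive_compose[OF recursive_triangle])

text \<open>The length of the list is fixed and only its entries vary with \<open>n\<close>, so
  finitely many nested pairings suffice.\<close>

lemma recursive_list_encode:
  "(\<And>x. x \<in> set xs \<Longrightarrow> recursive (F x)) \<Longrightarrow> recursive (\<lambda>n. list_encode (map (\<lambda>x. F x n) xs))"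
  by (induction xs)
     (simp_all add: recursive_const recursive_compose[OF recursive_Suc] recursive_prod_encode)

section \<open>An undecidable number rewriting system\<close>

datatype ex = Var nat | Cst nat | Pls ex ex | Pr ex ex

fun val :: "(nat \<Rightarrow> nat) \<Rightarrow> ex \<Rightarrow> nat" where
  "val y (Var i) = y i"
| "val y (Cst c) = c"
| "val y (Pls a b) = val y a + val y b"
| "val y (Pr a b) = prod_encode (val y a, val y b)"

text \<open>Variables of \<open>Q\<close> that do not occur in \<open>P\<close> are left free by
  \<open>c\<close>; choosing them is the nondeterministic guess.\<close>

definition step :: "(ex \<times> ex) set \<Rightarrow> nat \<Rightarrow> nat \<Rightarrow> bool" where
  "step R c c' \<longleftrightarrow> (\<exists>(P, Q) \<in> R. \<exists>y. c = val y P \<and> c' = val y Q)"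

section \<open>Coding of recursive functions and goal stacks\<close>

fun recf_code :: "recf \<Rightarrow> nat" where
  "recf_code Zero = prod_encode (0, 0)"
| "recf_code Succ = prod_encode (1, 0)"
| "recf_code (Proj i) = prod_encode (2, i)"
| "recf_code (Comp f gs) = prod_encode (3, prod_encode (recf_code f, list_encode (map recf_code gs)))"
| "recf_code (Prim f g) = prod_encode (4, prod_encode (recf_code f, recf_code g))"
| "recf_code (Mu f) = prod_encode (5, recf_code f)"

lemma recf_code_inject: "recf_code f = recf_code g \<longleftrightarrow> f = g"
proof (induction f arbitrary: g)
  case (Comp f gs)
  have "map recf_code gs = map recf_code hs \<longleftrightarrow> gs = hs" for hs
    using list.inj_map_strong[of gs hs recf_code recf_code] Comp.IH(2) by blast
  then show ?case by (cases g) (simp_all add: Comp.IH(1) prod_encode_eq list_encode_eq)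
qed (case_tac g; simp add: prod_encode_eq list_encode_eq)+

text \<open>\<open>Evals\<close> treats the arguments of a \<open>Comp\<close> one by one;
  \<open>Positive\<close> is the second premise of \<open>eval_mu\<close>, worked off downwards from
  \<open>n\<close>.\<close>

datatype goal =
  Eval recf "nat list" nat
| Evals "recf list" "nat list" "nat list"
| Positive recf nat "nat list"

fun goal_holds :: "goal \<Rightarrow> bool" where
  "goal_holds (Eval f xs y) \<longleftrightarrow> eval f xs y"
| "goal_holds (Evals gs xs ys) \<longleftrightarrow> list_all2 (\<lambda>g y. eval g xs y) gs ys"
| "goal_holds (Positive f n xs) \<longleftrightarrow> (\<forall>m<n. \<exists>y. eval f (m # xs) y \<and> y > 0)"

fun goal_code :: "goal \<Rightarrow> nat" where
  "goal_code (Eval f xs y) =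
     prod_encode (0, prod_encode (recf_code f, prod_encode (list_encode xs, y)))"
| "goal_code (Evals gs xs ys) =
     prod_encode (1, prod_encode (list_encode (map recf_code gs), prod_encode (list_encode xs, list_encode ys)))"
| "goal_code (Positive f n xs) =
     prod_encode (2, prod_encode (recf_code f, prod_encode (n, list_encode xs)))"

text \<open>The empty stack has code 0, so an evaluation succeeds exactly when the number 0 is
  reached.\<close>

definition goals_code :: "goal list \<Rightarrow> nat" where
  "goals_code gs = list_encode (map goal_code gs)"

abbreviation "ESuc a \<equiv> Pls (Cst 1) a"
abbreviation "ECons a b \<equiv> ESuc (Pr a b)"
abbreviation "EEval f xs y \<equiv> Pr (Cst 0) (Pr f (Pr xs y))"
abbreviation "EEvals gs xs ys \<equiv> Pr (Cst 1) (Pr gs (Pr xs ys))"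
abbreviation "EPositive f n xs \<equiv> Pr (Cst 2) (Pr f (Pr n xs))"
abbreviation "EProj i \<equiv> Pr (Cst 2) i"
abbreviation "EComp f gs \<equiv> Pr (Cst 3) (Pr f gs)"
abbreviation "EPrim f g \<equiv> Pr (Cst 4) (Pr f g)"
abbreviation "EMu f \<equiv> Pr (Cst 5) f"

text \<open>\<open>ECons\<close> mirrors \<open>list_encode\<close> on a nonempty list, so the top
  goal is matched while the rest \<open>k\<close> remains one number. The index of
  \<open>Proj\<close>, the argument list of \<open>Comp\<close> and the bound in \<open>Mu\<close>
  are unfolded by a base rule and a recursive rule each.\<close>

definition recf_rules :: "(ex \<times> ex) list" where
  "recf_rules = (let k = Var 0; f = Var 1; g = Var 2; xs = Var 3; y = Var 4; x = Var 5; z = Var 6 in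
   [(ECons (EEval (Pr (Cst 0) (Cst 0)) xs (Cst 0)) k, k),
    (ECons (EEval (Pr (Cst 1) (Cst 0)) (ECons x xs) (ESuc x)) k, k),
    (ECons (EEval (EProj (Cst 0)) (ECons x xs) x) k, k),
    (ECons (EEval (EProj (ESuc f)) (ECons x xs) y) k, ECons (EEval (EProj f) xs y) k),
    (ECons (EEval (EComp f g) xs z) k, ECons (EEvals g xs y) (ECons (EEval f y z) k)),
    (ECons (EEvals (Cst 0) xs (Cst 0)) k, k),
    (ECons (EEvals (ECons f g) xs (ECons x y)) k, ECons (EEval f xs x) (ECons (EEvals g xs y) k)),
    (ECons (EEval (EPrim f g) (ECons (Cst 0) xs) y) k, ECons (EEval f xs y) k),
    (ECons (EEval (EPrim f g) (ECons (ESuc x) xs) z) k,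
       ECons (EEval (EPrim f g) (ECons x xs) y) (ECons (EEval g (ECons y (ECons x xs)) z) k)),
    (ECons (EEval (EMu f) xs x) k,
       ECons (EEval f (ECons x xs) (Cst 0)) (ECons (EPositive f x xs) k)),
    (ECons (EPositive f (Cst 0) xs) k, k),
    (ECons (EPositive f (ESuc x) xs) k,
       ECons (EEval f (ECons x xs) (ESuc y)) (ECons (EPositive f x xs) k))])"

abbreviation "recf_step \<equiv> step (set recf_rules)"

lemmas recf_step_trans = converse_rtranclp_into_rtranclp[of recf_step]

lemma goals_code_simps [simp]:
  "goals_code [] = 0"
  "goals_code (g # gs) = Suc (prod_encode (goal_code g, goals_code gs))"
  by (simp_all add: goals_code_def)

section \<open>Soundness of the rewriting rules\<close>

lemma goals_code_eq_iff:
  "goals_code gs = Suc (prod_encode (a, b)) \<longleftrightarrow>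
   (\<exists>g gs'. gs = g # gs' \<and> a = goal_code g \<and> b = goals_code gs')"
  by (cases gs) auto

text \<open>Inversion: since the tags separate the constructors, matching a code against the
  left-hand side of a rule recovers the goal.\<close>

lemma goal_code_eq_iff:
  "goal_code g = prod_encode (0, prod_encode (a, prod_encode (b, y))) \<longleftrightarrow>
   (\<exists>f xs. g = Eval f xs y \<and> a = recf_code f \<and> b = list_encode xs)"
  "goal_code g = prod_encode (Suc 0, prod_encode (a, prod_encode (b, c))) \<longleftrightarrow>
   (\<exists>gs xs ys. g = Evals gs xs ys \<and> a = list_encode (map recf_code gs) \<and>
     b = list_encode xs \<and> c = list_encode ys)"
  "goal_code g = prod_encode (2, prod_encode (a, prod_encode (n, b))) \<longleftrightarrow>
   (\<exists>f xs. g = Positive f n xs \<and> a = recf_code f \<and> b = list_encode xs)"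
  by (cases g; auto)+

lemma recf_code_eq_iff:
  "recf_code f = prod_encode (0, 0) \<longleftrightarrow> f = Zero"
  "recf_code f = prod_encode (Suc 0, 0) \<longleftrightarrow> f = Succ"
  "recf_code f = prod_encode (2, i) \<longleftrightarrow> f = Proj i"
  "recf_code f = prod_encode (3, prod_encode (a, b)) \<longleftrightarrow>
   (\<exists>h gs. f = Comp h gs \<and> a = recf_code h \<and> b = list_encode (map recf_code gs))"
  "recf_code f = prod_encode (4, prod_encode (a, b)) \<longleftrightarrow>
   (\<exists>g h. f = Prim g h \<and> a = recf_code g \<and> b = recf_code h)"
  "recf_code f = prod_encode (5, a) \<longleftrightarrow> (\<exists>g. f = Mu g \<and> a = recf_code g)"
  by (cases f; auto)+

lemma map_eq_Cons_iff: "map h zs = a # ys \<longleftrightarrow> (\<exists>z zs'. zs = z # zs' \<and> a = h z \<and> ys = map h zs')"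
  by (cases zs) auto

lemma list_encode_eq_iff:
  "list_encode xs = 0 \<longleftrightarrow> xs = []"
  "list_encode xs = Suc (prod_encode (a, b)) \<longleftrightarrow> (\<exists>ys. xs = a # ys \<and> b = list_encode ys)"
  by (cases xs; auto)+

lemma nat_eq_list_encode: "n = list_encode xs \<longleftrightarrow> xs = list_decode n"
  by auto

lemmas code_eq_iffs = list_encode_eq_iff map_eq_Cons_iff goals_code_eq_iff goal_code_eq_iff recf_code_eq_iff

lemma eval_Proj_Suc: "eval (Proj i) xs y \<Longrightarrow> eval (Proj (Suc i)) (x # xs) y"
  by (auto elim!: eval_ProjE intro: eval_Proj)

lemma map_recf_code_inject: "map recf_code gs = map recf_code hs \<longleftrightarrow> gs = hs"
  by (rule inj_map_eq_map) (simp add: inj_def recf_code_inject)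

lemma goal_code_inject: "goal_code g = goal_code h \<longleftrightarrow> g = h"
  by (cases g; cases h) (auto simp: list_encode_eq recf_code_inject map_recf_code_inject)

lemma goals_code_inject: "goals_code gs = goals_code hs \<longleftrightarrow> gs = hs"
  unfolding goals_code_def list_encode_eq
  by (rule inj_map_eq_map) (simp add: inj_def goal_code_inject)

text \<open>The stack structure survives every step. The only guess that has to be a code is the
  list of intermediate results in the rule for \<open>Comp\<close>, and every number is the code of
  a list.\<close>

lemma step_recf_rules_sound:
  assumes "recf_step (goals_code gs) c'"
  shows "\<exists>gs'. goals_code gs' = c' \<and> (list_all goal_holds gs' \<longrightarrow> list_all goal_holds gs)"
proof -
  from assms obtain P Q y where "(P, Q) \<in> set recf_rules"
    and c: "goals_code gs = val y P" and c': "c' = val y Q"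
    unfolding step_def by blast
  \<comment> \<open>One case per rule: inverting the codes reveals the goals before and after the
    step, and an introduction rule of \<open>eval\<close> or the meaning of the goals gives the
    implication.\<close>
  then show ?thesis
    unfolding recf_rules_def Let_def
    by (simp, elim disjE;
        simp add: code_eq_iffs code_eq_iffs[THEN trans[OF eq_commute]] nat_eq_list_encode[of "y 4"];
        elim conjE exE;
        simp add: recf_code_inject goals_code_inject map_recf_code_inject list_encode_eq)
       (rule impI, (elim conjE)?, rule eval_zero eval_succ
        | (rule impI, (elim conjE)?, erule eval_Proj_Suc eval_prim0)
        | rule impI, rule eval_Proj; simp
        | (rule impI, elim conjE, erule eval_mu eval_comp eval_primS, assumption)
        | (simp add: less_Suc_eq, blast; fail))+
qed

lemma steps_recf_rules_sound:
  assumes "recf_step\<^sup>*\<^sup>* (goals_code gs) 0"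
  shows "list_all goal_holds gs"
proof -
  have "recf_step\<^sup>*\<^sup>* c 0 \<Longrightarrow> c = goals_code gs \<Longrightarrow> list_all goal_holds gs" for c
  proof (induction arbitrary: gs rule: converse_rtranclp_induct)
    case base
    then show ?case by (cases gs) auto
  next
    case (step c c')
    then show ?case using step_recf_rules_sound by blast
  qed
  with assms show ?thesis by blast
qed

section \<open>Completeness of the rewriting rules\<close>

definition push :: "goal \<Rightarrow> nat \<Rightarrow> nat" where
  "push g k = Suc (prod_encode (goal_code g, k))"

lemma step_nthI:
  "i < length R \<Longrightarrow> c = val y (fst (R ! i)) \<Longrightarrow> c' = val y (snd (R ! i)) \<Longrightarrow> step (set R) c c'"
  unfolding step_def by (rule bexI[OF _ nth_mem]) (auto simp: split_beta)

lemma recf_rules_step: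
  defines "S \<equiv> recf_step"
  shows "S (push (Eval Zero xs 0) k) k"
    and "S (push (Eval Succ (x # xs) (Suc x)) k) k"
    and "S (push (Eval (Proj 0) (x # xs) x) k) k"
    and "S (push (Eval (Proj (Suc i)) (x # xs) y) k) (push (Eval (Proj i) xs y) k)"
    and "S (push (Eval (Comp f gs) xs z) k) (push (Evals gs xs ys) (push (Eval f ys z) k))"
    and "S (push (Evals [] xs []) k) k"
    and "S (push (Evals (g # gs) xs (y # ys)) k) (push (Eval g xs y) (push (Evals gs xs ys) k))"
    and "S (push (Eval (Prim f g) (0 # xs) y) k) (push (Eval f xs y) k)"
    and "S (push (Eval (Prim f g) (Suc x # xs) z) k)
           (push (Eval (Prim f g) (x # xs) y) (push (Eval g (y # x # xs) z) k))"
    and "S (push (Eval (Mu f) xs x) k) (push (Eval f (x # xs) 0) (push (Positive f x xs) k))"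
    and "S (push (Positive f 0 xs) k) k"
    and "S (push (Positive f (Suc x) xs) k) (push (Eval f (x # xs) (Suc y)) (push (Positive f x xs) k))"
proof -
  let ?F = "recf_code f" and ?G = "recf_code g" and ?GS = "list_encode (map recf_code gs)"
    and ?X = "list_encode xs"
  \<comment> \<open>Each list below gives the values of \<open>k\<close>, \<open>f\<close>,
    \<open>g\<close>, \<open>xs\<close>, \<open>y\<close>, \<open>x\<close>, \<open>z\<close> in
    this order, with 0 for variables that are absent from the rule.\<close>
  show "S (push (Eval Zero xs 0) k) k"
    unfolding S_def by (rule step_nthI[of 0 _ _ "(!) [k, 0, 0, ?X]"]) (simp_all add: push_def recf_rules_def Let_def)
  show "S (push (Eval Succ (x # xs) (Suc x)) k) k"
    unfolding S_def by (rule step_nthI[of 1 _ _ "(!) [k, 0, 0, ?X, 0, x]"]) (simp_all add: push_def recf_rules_def Let_def)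
  show "S (push (Eval (Proj 0) (x # xs) x) k) k"
    unfolding S_def by (rule step_nthI[of 2 _ _ "(!) [k, 0, 0, ?X, 0, x]"]) (simp_all add: push_def recf_rules_def Let_def)
  show "S (push (Eval (Proj (Suc i)) (x # xs) y) k) (push (Eval (Proj i) xs y) k)"
    unfolding S_def by (rule step_nthI[of 3 _ _ "(!) [k, i, 0, ?X, y, x]"]) (simp_all add: push_def recf_rules_def Let_def)
  show "S (push (Eval (Comp f gs) xs z) k) (push (Evals gs xs ys) (push (Eval f ys z) k))"
    unfolding S_def by (rule step_nthI[of 4 _ _ "(!) [k, ?F, ?GS, ?X, list_encode ys, 0, z]"]) (simp_all add: push_def recf_rules_def Let_def)
  show "S (push (Evals [] xs []) k) k"
    unfolding S_def by (rule step_nthI[of 5 _ _ "(!) [k, 0, 0, ?X]"]) (simp_all add: push_def recf_rules_def Let_def)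
  show "S (push (Evals (g # gs) xs (y # ys)) k) (push (Eval g xs y) (push (Evals gs xs ys) k))"
    unfolding S_def by (rule step_nthI[of 6 _ _ "(!) [k, ?G, ?GS, ?X, list_encode ys, y]"]) (simp_all add: push_def recf_rules_def Let_def)
  show "S (push (Eval (Prim f g) (0 # xs) y) k) (push (Eval f xs y) k)"
    unfolding S_def by (rule step_nthI[of 7 _ _ "(!) [k, ?F, ?G, ?X, y]"]) (simp_all add: push_def recf_rules_def Let_def)
  show "S (push (Eval (Prim f g) (Suc x # xs) z) k) (push (Eval (Prim f g) (x # xs) y) (push (Eval g (y # x # xs) z) k))"
    unfolding S_def by (rule step_nthI[of 8 _ _ "(!) [k, ?F, ?G, ?X, y, x, z]"]) (simp_all add: push_def recf_rules_def Let_def)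
  show "S (push (Eval (Mu f) xs x) k) (push (Eval f (x # xs) 0) (push (Positive f x xs) k))"
    unfolding S_def by (rule step_nthI[of 9 _ _ "(!) [k, ?F, 0, ?X, 0, x]"]) (simp_all add: push_def recf_rules_def Let_def)
  show "S (push (Positive f 0 xs) k) k"
    unfolding S_def by (rule step_nthI[of 10 _ _ "(!) [k, ?F, 0, ?X]"]) (simp_all add: push_def recf_rules_def Let_def)
  show "S (push (Positive f (Suc x) xs) k) (push (Eval f (x # xs) (Suc y)) (push (Positive f x xs) k))"
    unfolding S_def by (rule step_nthI[of 11 _ _ "(!) [k, ?F, 0, ?X, y, x]"]) (simp_all add: push_def recf_rules_def Let_def)
qed

text \<open>The rest \<open>k\<close> of the stack is arbitrary so that the induction hypotheses can
  be chained: the premises of a rule are solved one after another, each on top of those still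
  pending.\<close>

lemma steps_Eval_complete:
  "eval f xs y \<Longrightarrow> recf_step\<^sup>*\<^sup>* (push (Eval f xs y) k) k"
proof (induction arbitrary: k rule: eval.induct)
  case (eval_proj i xs)
  then show ?case
  proof (induction i arbitrary: xs)
    case 0
    then show ?case by (cases xs) (auto intro: recf_rules_step)
  next
    case (Suc i)
    then show ?case by (cases xs) (auto intro: recf_step_trans[OF recf_rules_step(4)])
  qed
next
  case (eval_comp xs gs ys f z)
  have "recf_step\<^sup>*\<^sup>* (push (Evals gs xs ys) k) k" for k
    using eval_comp.IH(1)
  proof (induction arbitrary: k rule: list_all2_induct)
    case (Cons g gs y ys)
    have "recf_step\<^sup>*\<^sup>* (push (Eval g xs y) (push (Evals gs xs ys) k)) (push (Evals gs xs ys) k)"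
      using Cons.hyps by blast
    also have "recf_step\<^sup>*\<^sup>* \<dots> k" by (rule Cons.IH)
    finally show ?case by (rule recf_step_trans[OF recf_rules_step(7)])
  qed (auto intro: recf_rules_step)
  then have "recf_step\<^sup>*\<^sup>* (push (Evals gs xs ys) (push (Eval f ys z) k)) (push (Eval f ys z) k)" .
  also have "recf_step\<^sup>*\<^sup>* \<dots> k" by (rule eval_comp.IH)
  finally show ?case by (rule recf_step_trans[OF recf_rules_step(5)])
next
  case (eval_prim0 f xs y g)
  then show ?case by (blast intro: recf_step_trans[OF recf_rules_step(8)])
next
  case (eval_primS f g n xs y z)
  then show ?case
    by (blast intro: recf_step_trans[OF recf_rules_step(9)] rtranclp_trans)
next
  case (eval_mu f n xs)
  have "m \<le> n \<Longrightarrow> recf_step\<^sup>*\<^sup>* (push (Positive f m xs) k) k" for m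
  proof (induction m)
    case (Suc m)
    then obtain y where "y > 0" "\<And>k. recf_step\<^sup>*\<^sup>* (push (Eval f (m # xs) y) k) k"
      using eval_mu.IH(2) by (metis Suc_le_lessD)
    then have "recf_step\<^sup>*\<^sup>* (push (Eval f (m # xs) (Suc (y - 1))) (push (Positive f m xs) k)) (push (Positive f m xs) k)"
      by simp
    also have "recf_step\<^sup>*\<^sup>* \<dots> k" using Suc by simp
    finally show ?case by (rule recf_step_trans[OF recf_rules_step(12)])
  qed (auto intro: recf_rules_step)
  then have "recf_step\<^sup>*\<^sup>* (push (Positive f n xs) k) k" by simp
  with eval_mu.IH(1) have "recf_step\<^sup>*\<^sup>* (push (Eval f (n # xs) 0) (push (Positive f n xs) k)) k"
    by (blast intro: rtranclp_trans)
  then show ?case by (rule recf_step_trans[OF recf_rules_step(10)])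
qed (auto intro: recf_rules_step)

lemma steps_Eval_iff: "recf_step\<^sup>*\<^sup>* (push (Eval f xs y) 0) 0 \<longleftrightarrow> eval f xs y"
  using steps_recf_rules_sound[of "[Eval f xs y]"] steps_Eval_complete[of f xs y 0]
  by (auto simp: push_def)

text \<open>Diagonalization: a decider \<open>D\<close> would give a program \<open>p\<close> that
  yields 0 on its own code exactly if \<open>D\<close> denies this.\<close>

lemma steps_undecidable:
  assumes "recursive D"
  shows "\<exists>c. D c \<noteq> (if recf_step\<^sup>*\<^sup>* c 0 then 1 else 0)"
proof (rule ccontr)
  assume "\<not> ?thesis"
  then have D: "D c = (if recf_step\<^sup>*\<^sup>* c 0 then 1 else 0)" for c by blast
  \<comment> \<open>\<open>start x\<close> codes the single goal that the program with code
    \<open>x\<close> yields 0 on input \<open>x\<close>.\<close>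
  define start where
    "start x = Suc (prod_encode (prod_encode (0, prod_encode (x, prod_encode (Suc (prod_encode (x, 0)), 0))), 0))" for x
  have start: "start (recf_code p) = push (Eval p [recf_code p] 0) 0" for p
    by (simp add: start_def push_def)
  have "recursive start"
    unfolding start_def
    by (intro recursive_compose[OF recursive_Suc] recursive_prod_encode recursive_const recursive_id)
  from recursive_compose[OF assms this] obtain d where d: "eval d [n] (D (start n))" for n
    unfolding recursive_def by blast
  \<comment> \<open>The body of the search ignores its counter: on input \<open>x\<close> the search
    stops at once with 0 if \<open>D (start x) = 0\<close> and never stops otherwise.\<close>
  define p where "p = Mu (Comp d [Proj 1])"
  let ?x = "recf_code p"
  have d': "eval (Comp d [Proj 1]) [m, n] (D (start n))" for m n
    by (rule eval_Comp1[OF eval_Proj d]) auto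
  have "D (start ?x) = 1 \<longleftrightarrow> eval p [?x] 0"
    by (simp add: D start steps_Eval_iff)
  also have "\<dots> \<longleftrightarrow> D (start ?x) = 0"
  proof
    assume "eval p [?x] 0"
    then have "eval (Comp d [Proj 1]) [0, ?x] 0" unfolding p_def by (auto elim: eval_MuE)
    then show "D (start ?x) = 0" using d'[of 0 ?x] eval_deterministic by blast
  next
    assume "D (start ?x) = 0"
    then have "eval (Comp d [Proj 1]) [0, ?x] 0" using d'[of 0 ?x] by simp
    then show "eval p [?x] 0" unfolding p_def by (auto intro: eval_mu)
  qed
  finally show False using D[of "start ?x"] by (auto split: if_splits)
qed

section \<open>Rational linear representations\<close>

declare digits.simps [simp del]

definition rat_rep :: "rat \<Rightarrow> algrep" where
  "rat_rep q = ([- q, 1], q, q)"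

lemma alg_roots_in_rat_rep: "alg_roots_in (rat_rep q) = {of_rat q}"
proof -
  have "map_poly real_of_rat [:- q, 1:] = [:- of_rat q, 1:]"
    by (simp add: map_poly_pCons of_rat_minus)
  then show ?thesis
    unfolding alg_roots_in_def rat_rep_def alg_poly_def by auto
qed

lemma alg_val_rat_rep: "alg_val (rat_rep q) = of_rat q"
  unfolding alg_val_def alg_roots_in_rat_rep by simp

lemma valid_rat_rep: "valid_alg (rat_rep q)"
proof -
  have "irreducible [:- q, 1:]"
    by (rule irreducible_linear_field_poly) simp
  then show ?thesis
    unfolding valid_alg_def alg_roots_in_rat_rep by (simp add: alg_poly_def rat_rep_def)
qed

definition rat_linrep :: "nat \<Rightarrow> nat \<Rightarrow> (nat \<Rightarrow> rat) \<Rightarrow> (nat \<Rightarrow> rat) \<Rightarrow> (nat \<Rightarrow> nat \<Rightarrow> nat \<Rightarrow> rat) \<Rightarrow> linrep" where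
  "rat_linrep k r v w M =
    (r, map (\<lambda>i. rat_rep (v i)) [0..<r], map (\<lambda>i. rat_rep (w i)) [0..<r],
     map (\<lambda>d. map (\<lambda>i. map (\<lambda>j. rat_rep (M d i j)) [0..<r]) [0..<r]) [0..<k])"

text \<open>Rational entries lie in every admissible \<open>S\<close>, so one reduction serves all
  these rings.\<close>

lemma valid_rat_linrep:
  assumes "\<rat> \<subseteq> S"
  shows "valid_linrep k S (rat_linrep k r v w M)"
proof -
  have "real_of_rat q \<in> S" for q
    using assms Rats_of_rat by blast
  then show ?thesis
    unfolding valid_linrep_def rat_linrep_def by (auto simp: valid_rat_rep alg_val_rat_rep)
qed

section \<open>Matrix products as actions on row vectors\<close>

lemma matprod_cong:
  assumes "\<And>d i j. d \<in> set ds \<Longrightarrow> i < r \<Longrightarrow> j < r \<Longrightarrow> M d i j = M' d i j"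
    and "i < r" "j < r"
  shows "matprod r M ds i j = matprod r M' ds i j"
  using assms
  by (induction ds arbitrary: i j) (auto simp: matmul_def intro!: sum.cong)

definition row_act :: "'i set \<Rightarrow> ('i \<Rightarrow> 'i \<Rightarrow> real) \<Rightarrow> ('i \<Rightarrow> real) \<Rightarrow> 'i \<Rightarrow> real" where
  "row_act I A x = (\<lambda>j. \<Sum>i\<in>I. x i * A i j)"

lemma row_act_cong: "(\<And>i. i \<in> I \<Longrightarrow> x i = y i) \<Longrightarrow> row_act I A x = row_act I A y"
  unfolding row_act_def by simp

text \<open>Multiplying from the left turns the product into a state machine that reads the least
  significant digit first. The bijection \<open>h\<close> allows matrices indexed by any finite
  set.\<close>

lemma matprod_row_act:
  assumes h: "bij_betw h {..<r} I"
  shows "(\<Sum>i<r. \<Sum>j<r. v (h i) * matprod r (\<lambda>d i j. M d (h i) (h j)) ds i j * w (h j)) =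
         (\<Sum>j\<in>I. foldl (\<lambda>x d. row_act I (M d) x) v ds j * w j)"
proof (induction ds arbitrary: v)
  case Nil
  have "(\<Sum>i<r. \<Sum>j<r. v (h i) * idmat i j * w (h j)) = (\<Sum>i<r. v (h i) * w (h i))"
    by (intro sum.cong refl) (simp add: idmat_def if_distrib[of "\<lambda>x. _ * x * _"] cong: if_cong)
  also have "\<dots> = (\<Sum>j\<in>I. v j * w j)"
    by (rule sum.reindex_bij_betw[OF h])
  finally show ?case by simp
next
  case (Cons d ds)
  let ?P = "matprod r (\<lambda>d i j. M d (h i) (h j)) ds"
  have "(\<Sum>i<r. \<Sum>j<r. v (h i) * matprod r (\<lambda>d i j. M d (h i) (h j)) (d # ds) i j * w (h j)) =
        (\<Sum>i<r. \<Sum>j<r. \<Sum>l<r. v (h i) * M d (h i) (h l) * ?P l j * w (h j))"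
    by (simp add: matmul_def sum_distrib_left sum_distrib_right mult_ac)
  also have "\<dots> = (\<Sum>l<r. \<Sum>j<r. \<Sum>i<r. v (h i) * M d (h i) (h l) * ?P l j * w (h j))"
    by (subst sum.swap, subst (2) sum.swap, subst sum.swap) (rule refl)
  also have "\<dots> = (\<Sum>l<r. \<Sum>j<r. (\<Sum>i<r. v (h i) * M d (h i) (h l)) * ?P l j * w (h j))"
    by (simp add: sum_distrib_right)
  also have "\<dots> = (\<Sum>l<r. \<Sum>j<r. row_act I (M d) v (h l) * ?P l j * w (h j))"
    unfolding row_act_def by (subst sum.reindex_bij_betw[OF h, symmetric]) (rule refl)
  also have "\<dots> = (\<Sum>j\<in>I. foldl (\<lambda>x d. row_act I (M d) x) v (d # ds) j * w j)"
    by (simp add: Cons.IH)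
  finally show ?case .
qed

lemma digits_less: "k \<ge> 2 \<Longrightarrow> d \<in> set (digits k n) \<Longrightarrow> d < k"
  by (induction k n rule: digits.induct) (subst (asm) (2) digits.simps, auto split: if_splits)

lemma linrep_seq_rat_linrep:
  assumes k: "k \<ge> 2" and h: "bij_betw h {..<r} I"
  shows "linrep_seq k (rat_linrep k r (\<lambda>i. v (h i)) (\<lambda>i. w (h i)) (\<lambda>d i j. M d (h i) (h j))) n =
    (\<Sum>j\<in>I. foldl (\<lambda>x d. row_act I (\<lambda>i j. of_rat (M d i j)) x) (\<lambda>i. of_rat (v i)) (digits k n) j * of_rat (w j))"
proof -
  let ?M = "\<lambda>d i j. alg_val (map (\<lambda>d. map (\<lambda>i. map (\<lambda>j. rat_rep (M d (h i) (h j))) [0..<r]) [0..<r]) [0..<k] ! d ! i ! j)"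
  have "?M d i j = of_rat (M d (h i) (h j))" if "d < k" "i < r" "j < r" for d i j
    using that by (simp add: alg_val_rat_rep)
  then have "matprod r ?M (digits k n) i j = matprod r (\<lambda>d i j. of_rat (M d (h i) (h j))) (digits k n) i j"
    if "i < r" "j < r" for i j
    using that digits_less[OF k] by (intro matprod_cong) auto
  then have "linrep_seq k (rat_linrep k r (\<lambda>i. v (h i)) (\<lambda>i. w (h i)) (\<lambda>d i j. M d (h i) (h j))) n =
    (\<Sum>i<r. \<Sum>j<r. of_rat (v (h i)) * matprod r (\<lambda>d i j. of_rat (M d (h i) (h j))) (digits k n) i j * of_rat (w (h j)))"
    unfolding linrep_seq_def rat_linrep_def Let_def split_conv
    by (intro sum.cong refl) (simp add: alg_val_rat_rep)
  then show ?thesis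
    by (simp only: matprod_row_act[OF h, of "\<lambda>i. of_rat (v i)" "\<lambda>d i j. of_rat (M d i j)" _ "\<lambda>j. of_rat (w j)"])
qed

section \<open>Computability of encoded rational representations\<close>

text \<open>In the second equation the truncated subtraction covers the case \<open>a = 0\<close>.\<close>

lemma int_encode_of_nat: "int_encode (int a) = 2 * a" "int_encode (- int a) = 2 * a - 1"
  by (auto simp: int_encode_def sum_encode_def nat_minus_as_int)

lemma quotient_of_fraction:
  assumes "b > 0" "coprime a b"
  shows "quotient_of (of_nat a / of_nat b) = (int a, int b)"
    and "quotient_of (- (of_nat a / of_nat b)) = (- int a, int b)"
proof -
  have "of_nat a / of_nat b = Rat.Fract (int a) (int b)"
    by (simp add: Fract_of_int_quotient)
  moreover have "- (of_nat a / of_nat b) = Rat.Fract (- int a) (int b)"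
    by (simp add: Fract_of_int_quotient)
  ultimately show "quotient_of (of_nat a / of_nat b) = (int a, int b)"
    "quotient_of (- (of_nat a / of_nat b)) = (- int a, int b)"
    using assms by (simp_all only: quotient_of_Fract) (auto intro: normalize_stable)
qed

text \<open>\<open>enc_rat\<close> encodes the reduced fraction; coprimality makes the given
  fraction reduced already, so no gcd has to be computed. Both signs occur: the constant coefficient
  of the minimal polynomial is the negated number.\<close>

lemma recursive_enc_fraction:
  assumes "recursive a" "recursive b" "\<And>n. b n > 0" "\<And>n. coprime (a n) (b n)"
  shows "recursive (\<lambda>n. enc_alg (rat_rep (of_nat (a n) / of_nat (b n))))"
proof -
  have two: "recursive (\<lambda>n. 2 * F n)" if "recursive F" for F
    using recursive_mult[OF recursive_const that] .
  have "recursive (\<lambda>n. enc_rat (of_nat (a n) / of_nat (b n)))"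
    unfolding enc_rat_def quotient_of_fraction[OF assms(3,4)] split_conv int_encode_of_nat
    by (intro recursive_prod_encode two assms)
  moreover have "recursive (\<lambda>n. enc_rat (- (of_nat (a n) / of_nat (b n))))"
    unfolding enc_rat_def quotient_of_fraction[OF assms(3,4)] split_conv int_encode_of_nat
    by (intro recursive_prod_encode two assms recursive_compose[OF recursive_pred])
  ultimately show ?thesis
    unfolding enc_alg_def rat_rep_def split_conv
    using recursive_list_encode[of "[\<lambda>n. enc_rat (- (of_nat (a n) / of_nat (b n))), \<lambda>_. enc_rat 1]" "\<lambda>F. F"]
    by (intro recursive_prod_encode) (auto intro: recursive_const)
qed

lemma recursive_enc_rat_linrep:
  assumes "\<And>i. i < r \<Longrightarrow> recursive (\<lambda>n. enc_alg (rat_rep (v n i)))"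
    and "\<And>i. i < r \<Longrightarrow> recursive (\<lambda>n. enc_alg (rat_rep (w n i)))"
    and "\<And>d i j. d < k \<Longrightarrow> i < r \<Longrightarrow> j < r \<Longrightarrow> recursive (\<lambda>n. enc_alg (rat_rep (M n d i j)))"
  shows "recursive (\<lambda>n. enc_linrep (rat_linrep k r (v n) (w n) (M n)))"
  unfolding enc_linrep_def rat_linrep_def split_conv map_map o_def
  by (intro recursive_prod_encode recursive_const recursive_list_encode)
     (simp_all add: assms)

section \<open>Growth along digit words\<close>

fun of_digits :: "nat \<Rightarrow> nat list \<Rightarrow> nat" where
  "of_digits k [] = 0"
| "of_digits k (d # ds) = d + k * of_digits k ds"

lemma of_digits_pos: "k \<ge> 2 \<Longrightarrow> ds \<noteq> [] \<Longrightarrow> last ds \<noteq> 0 \<Longrightarrow> of_digits k ds > 0"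
  by (induction ds) (auto split: if_splits)

text \<open>The last digit of the list is the most significant one, so its being nonzero excludes
  leading zeros.\<close>

lemma digits_of_digits:
  assumes "k \<ge> 2" "\<forall>d\<in>set ds. d < k" "ds = [] \<or> last ds \<noteq> 0"
  shows "digits k (of_digits k ds) = ds"
  using assms
proof (induction ds)
  case Nil
  then show ?case by (simp add: digits.simps)
next
  case (Cons d ds)
  have IH: "digits k (of_digits k ds) = ds"
    using Cons by (auto split: if_splits)
  have pos: "of_digits k (d # ds) > 0"
    using Cons.prems by (intro of_digits_pos) auto
  then show ?case
    using Cons.prems IH by (subst digits.simps) (auto simp: div_add1_eq)
qed

lemma of_digits_less: "k \<ge> 2 \<Longrightarrow> \<forall>d\<in>set ds. d < k \<Longrightarrow> of_digits k ds < k ^ length ds"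
proof (induction ds)
  case (Cons d ds)
  then have "d + k * of_digits k ds < k * (of_digits k ds + 1)" by (simp add: algebra_simps)
  also have "\<dots> \<le> k * k ^ length ds" using Cons by (intro mult_left_mono) auto
  finally show ?case by simp
qed auto

lemma of_digits_ge:
  assumes "k \<ge> 2" "ds \<noteq> []" "last ds \<noteq> 0"
  shows "length ds \<le> of_digits k ds"
  using assms
proof (induction ds)
  case (Cons d ds)
  show ?case
  proof (cases "ds = []")
    case False
    with Cons have "length ds \<le> of_digits k ds" "of_digits k ds > 0"
      using of_digits_pos by auto
    then have "length ds + 1 \<le> 2 * of_digits k ds" by simp
    also have "\<dots> \<le> k * of_digits k ds" using Cons by (intro mult_right_mono) auto
    finally show ?thesis by simp
  qed (use Cons in auto)
qed auto

section \<open>Criteria for polynomial growth\<close>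

lemma not_has_poly_growth_bounded:
  assumes "\<And>n. \<bar>f n\<bar> \<le> 1"
  shows "\<not> has_poly_growth f"
proof -
  have "f \<in> O(\<lambda>n. real n powr \<sigma>)" if "\<sigma> > 0" for \<sigma>
  proof (rule bigoI[of _ 1])
    show "\<forall>\<^sub>F n in at_top. norm (f n) \<le> 1 * norm (real n powr \<sigma>)"
      using eventually_ge_at_top[of 1]
    proof eventually_elim
      case (elim n)
      then have "1 \<le> real n powr \<sigma>" using that by (simp add: ge_one_powr_ge_zero)
      then show ?case using assms[of n] by simp
    qed
  qed
  then show ?thesis unfolding has_poly_growth_def by blast
qed

text \<open>Geometric growth of the values along indices that grow at most geometrically is
  polynomial growth in the index.\<close>

lemma has_poly_growthI:
  fixes N :: "nat \<Rightarrow> nat" and K V :: real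
  assumes "V > 1" "K > 1" and ge: "\<And>m. m \<le> N m" and le: "\<And>m. real (N m) \<le> K ^ m"
    and f: "\<And>m. f (N m) = V ^ m"
  shows "has_poly_growth f"
proof -
  \<comment> \<open>Half of the critical exponent \<open>ln V / ln K\<close>: then
    \<open>K ^ m\<close> to the power \<open>\<sigma>\<close> is only the square root of
    \<open>V ^ m\<close>.\<close>
  define \<sigma> where "\<sigma> = ln V / (2 * ln K)"
  define q where "q = K powr \<sigma>"
  have \<sigma>: "\<sigma> > 0" unfolding \<sigma>_def using assms by simp
  have "q * q = K powr (2 * \<sigma>)" unfolding q_def by (simp flip: powr_add)
  also have "\<dots> = V" unfolding \<sigma>_def powr_def using assms by simp
  finally have qq: "q * q = V" .
  have q: "q > 1" unfolding q_def using \<open>K > 1\<close> \<sigma> by simp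
  have "f \<notin> O(\<lambda>n. real n powr \<sigma>)"
  proof
    assume "f \<in> O(\<lambda>n. real n powr \<sigma>)"
    then obtain c where c: "\<forall>\<^sub>F n in at_top. norm (f n) \<le> c * norm (real n powr \<sigma>)"
      by (auto elim: landau_o.bigE)
    have "filterlim N at_top at_top"
      by (rule filterlim_at_top_mono[OF filterlim_ident]) (simp add: ge)
    with c have "\<forall>\<^sub>F m in at_top. norm (f (N m)) \<le> c * norm (real (N m) powr \<sigma>)"
      by (rule eventually_compose_filterlim)
    then obtain m0 where m0: "\<And>m. m \<ge> m0 \<Longrightarrow> norm (f (N m)) \<le> c * norm (real (N m) powr \<sigma>)"
      unfolding eventually_at_top_linorder by blast
    obtain m1 where m1: "\<bar>c\<bar> < q ^ m1" using real_arch_pow[OF q] by blast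
    define m where "m = max m0 m1"
    have "\<bar>c\<bar> < q ^ m"
      using m1 by (rule less_le_trans) (use q in \<open>auto simp: m_def intro: power_increasing\<close>)
    moreover have "q ^ m \<le> \<bar>c\<bar>"
    proof -
      have "q ^ m * q ^ m = V ^ m" by (simp flip: qq power_mult_distrib)
      also have "\<dots> \<le> c * (real (N m) powr \<sigma>)" using m0[of m] f[of m] \<open>V > 1\<close> by (simp add: m_def)
      also have "\<dots> \<le> \<bar>c\<bar> * (K ^ m) powr \<sigma>"
        using le[of m] \<sigma> by (intro mult_mono powr_mono2) auto
      also have "(K ^ m) powr \<sigma> = q ^ m"
        unfolding q_def using \<open>K > 1\<close> by (simp add: powr_power flip: powr_realpow) (simp add: powr_powr mult.commute)
      finally show ?thesis using q by simp
    qed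
    ultimately show False by simp
  qed
  with \<sigma> show ?thesis unfolding has_poly_growth_def by blast
qed


section \<open>Words of integer matrices as digit words\<close>

text \<open>\<open>C\<close> bounds the absolute column sums of all letter matrices and of the test
  vector, so division by \<open>C\<close> at every letter keeps the rows bounded.\<close>

locale letter_system =
  fixes t :: nat and J :: "'j set" and A :: "nat \<Rightarrow> 'j \<Rightarrow> 'j \<Rightarrow> int" and \<tau> :: "'j \<Rightarrow> int" and C :: nat
  assumes t_pos: "t > 0" and C_pos: "C > 0" and finite_J: "finite J"
    and A_bound: "\<And>d l. d < t \<Longrightarrow> l \<in> J \<Longrightarrow> (\<Sum>j\<in>J. \<bar>A d j l\<bar>) \<le> int C"
    and \<tau>_bound: "(\<Sum>j\<in>J. \<bar>\<tau> j\<bar>) \<le> int C"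
begin

definition idx :: "(nat \<times> 'j option) set" where
  "idx = {..t} \<times> insert None (Some ` J)"

text \<open>The entries are polymorphic in the field: over \<open>rat\<close> they form the linear
  representation, over \<open>real\<close> they are analysed.\<close>

definition init_row :: "('j \<Rightarrow> int) \<Rightarrow> nat \<Rightarrow> 'j option \<Rightarrow> 'a :: field_char_0" where
  "init_row \<phi> N a = (case a of None \<Rightarrow> 1 | Some l \<Rightarrow> of_int (\<phi> l) / of_nat N)"

definition test_col :: "'j option \<Rightarrow> 'a :: field_char_0" where
  "test_col a = (case a of None \<Rightarrow> 1 | Some j \<Rightarrow> of_int (\<tau> j) / of_nat C)"

definition letter_mat :: "nat \<Rightarrow> 'j option \<Rightarrow> 'j option \<Rightarrow> 'a :: field_char_0" where
  "letter_mat b a a' = (case (a, a') of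
     (None, None) \<Rightarrow> 1 | (Some j, Some l) \<Rightarrow> of_int (A b j l) / of_nat C | _ \<Rightarrow> 0)"

text \<open>
  The index \<open>(b, a)\<close> says that \<open>b\<close> zeros have been read since the last nonzero digit. A nonzero digit
  then applies letter \<open>b\<close> if \<open>b < t\<close>, and starts a new word if \<open>b = t\<close>. Component \<open>None\<close> carries the
  product of the values of the completed words, component \<open>Some j\<close> feature \<open>j\<close> of the current word;
  they are combined into the value of the word when the zero count reaches \<open>t\<close>.
\<close>

definition digit_mat ::
  "('j \<Rightarrow> int) \<Rightarrow> nat \<Rightarrow> nat \<Rightarrow> nat \<times> 'j option \<Rightarrow> nat \<times> 'j option \<Rightarrow> 'a :: field_char_0" where
  "digit_mat \<phi> N d = (\<lambda>(b, a) (b', a').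
     if d = 0 then
       if b' \<noteq> Suc b then 0
       else if b' < t then of_bool (a = a')
       else if a' = None then test_col a else 0
     else if b' \<noteq> 0 then 0
     else if b < t then letter_mat b a a'
     else if a = None then init_row \<phi> N a' else 0)"

definition init_vec :: "('j \<Rightarrow> int) \<Rightarrow> nat \<Rightarrow> nat \<times> 'j option \<Rightarrow> 'a :: field_char_0" where
  "init_vec \<phi> N = (\<lambda>(b, a). if b = 0 then init_row \<phi> N a else 0)"

definition final_vec :: "nat \<times> 'j option \<Rightarrow> 'a :: field_char_0" where
  "final_vec = (\<lambda>i. of_bool (i = (0, None)))"

section \<open>Integer features of words and their bounds\<close>

definition feature :: "('j \<Rightarrow> int) \<Rightarrow> nat list \<Rightarrow> 'j \<Rightarrow> int" where
  "feature \<phi> u = foldl (\<lambda>x d l. \<Sum>j\<in>J. x j * A d j l) \<phi> u"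

lemma feature_snoc: "feature \<phi> (u @ [d]) l = (\<Sum>j\<in>J. feature \<phi> u j * A d j l)"
  by (simp add: feature_def)

definition test :: "('j \<Rightarrow> int) \<Rightarrow> nat list \<Rightarrow> int" where
  "test \<phi> u = (\<Sum>j\<in>J. feature \<phi> u j * \<tau> j)"

text \<open>Hoelder's inequality for the maximum norm and the sum norm.\<close>

lemma weighted_sum_bound:
  fixes x c :: "'j \<Rightarrow> int"
  assumes "\<And>j. j \<in> J \<Longrightarrow> \<bar>x j\<bar> \<le> X" "(\<Sum>j\<in>J. \<bar>c j\<bar>) \<le> int C" "X \<ge> 0"
  shows "\<bar>\<Sum>j\<in>J. x j * c j\<bar> \<le> X * int C"
proof -
  have "\<bar>\<Sum>j\<in>J. x j * c j\<bar> \<le> (\<Sum>j\<in>J. \<bar>x j * c j\<bar>)" by (rule sum_abs)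
  also have "\<dots> \<le> (\<Sum>j\<in>J. X * \<bar>c j\<bar>)"
    by (intro sum_mono) (simp add: abs_mult mult_right_mono assms)
  also have "\<dots> = X * (\<Sum>j\<in>J. \<bar>c j\<bar>)" by (simp add: sum_distrib_left)
  also have "\<dots> \<le> X * int C" by (intro mult_left_mono assms)
  finally show ?thesis .
qed

lemma feature_bound:
  assumes "\<And>l. l \<in> J \<Longrightarrow> \<bar>\<phi> l\<bar> \<le> int N" "set u \<subseteq> {..<t}" "l \<in> J"
  shows "\<bar>feature \<phi> u l\<bar> \<le> int (N * C ^ length u)"
  using assms(2,3)
proof (induction u arbitrary: l rule: rev_induct)
  case Nil
  then show ?case using assms(1) by (simp add: feature_def)
next
  case (snoc d u)
  then show ?case
    using weighted_sum_bound[of "feature \<phi> u" "int (N * C ^ length u)" "\<lambda>j. A d j l"] A_bound[of d l]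
    by (simp add: feature_snoc mult_ac)
qed

lemma test_bound:
  assumes "\<And>l. l \<in> J \<Longrightarrow> \<bar>\<phi> l\<bar> \<le> int N" "set u \<subseteq> {..<t}"
  shows "\<bar>test \<phi> u\<bar> \<le> int (N * C ^ Suc (length u))"
  using weighted_sum_bound[of "feature \<phi> u" "int (N * C ^ length u)" \<tau>] feature_bound[OF assms] \<tau>_bound
  by (simp add: test_def mult_ac)

text \<open>The initial row contributes the factor \<open>1 / N\<close>, every letter
  \<open>1 / C\<close>, and the test column one more \<open>1 / C\<close>.\<close>

definition word_value :: "('j \<Rightarrow> int) \<Rightarrow> nat \<Rightarrow> nat list \<Rightarrow> real" where
  "word_value \<phi> N u = 1 + of_int (test \<phi> u) / real (N * C ^ Suc (length u))"

definition word_row :: "('j \<Rightarrow> int) \<Rightarrow> nat \<Rightarrow> nat list \<Rightarrow> 'j option \<Rightarrow> real" where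
  "word_row \<phi> N u a = (case a of None \<Rightarrow> 1 | Some l \<Rightarrow> of_int (feature \<phi> u l) / real (N * C ^ length u))"

text \<open>These are the rows that arise from the initial row before an overflow of zeros:
  \<open>p\<close> is the product of the completed words and \<open>u\<close> the current word. At
  \<open>b = t\<close> the value of the word just finished is already part of
  \<open>p\<close>.\<close>

definition row_state ::
  "('j \<Rightarrow> int) \<Rightarrow> nat \<Rightarrow> nat \<Rightarrow> real \<Rightarrow> nat list \<Rightarrow> nat \<times> 'j option \<Rightarrow> real" where
  "row_state \<phi> N b p u = (\<lambda>(b', a).
     if b' \<noteq> b then 0 else if b < t then p * word_row \<phi> N u a else of_bool (a = None) * p)"

lemma finite_idx: "finite idx"
  unfolding idx_def using finite_J by simp

lemma sum_Some_J: "(\<Sum>a\<in>insert None (Some ` J). F a) = F None + (\<Sum>j\<in>J. F (Some j))"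
  using finite_J by (simp add: sum.reindex image_iff)

lemma sum_row_state:
  assumes "b \<le> t"
  shows "(\<Sum>i\<in>idx. row_state \<phi> N b p u i * F i) =
    (if b < t then p * (F (b, None) + (\<Sum>j\<in>J. of_int (feature \<phi> u j) / real (N * C ^ length u) * F (b, Some j)))
     else p * F (b, None))"
proof -
  have "(\<Sum>i\<in>idx. row_state \<phi> N b p u i * F i) =
        (\<Sum>b'\<le>t. \<Sum>a\<in>insert None (Some ` J). row_state \<phi> N b p u (b', a) * F (b', a))"
    unfolding idx_def sum.cartesian_product by (simp add: split_def)
  also have "\<dots> = (\<Sum>b'\<le>t. if b' = b then \<Sum>a\<in>insert None (Some ` J). row_state \<phi> N b p u (b, a) * F (b, a) else 0)"
    by (intro sum.cong refl) (auto simp: row_state_def)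
  also have "\<dots> = (\<Sum>a\<in>insert None (Some ` J). row_state \<phi> N b p u (b, a) * F (b, a))"
    using assms by simp
  finally show ?thesis
    unfolding sum_Some_J by (simp add: row_state_def word_row_def sum_distrib_left algebra_simps)
qed

abbreviation digit_act :: "('j \<Rightarrow> int) \<Rightarrow> nat \<Rightarrow> nat \<Rightarrow> (nat \<times> 'j option \<Rightarrow> real) \<Rightarrow> nat \<times> 'j option \<Rightarrow> real" where
  "digit_act \<phi> N d \<equiv> row_act idx (digit_mat \<phi> N d)"

section \<open>Effect of a single digit\<close>

lemma digit_act_shift:
  assumes "Suc b < t" "i \<in> idx"
  shows "digit_act \<phi> N 0 (row_state \<phi> N b p u) i = row_state \<phi> N (Suc b) p u i"
proof -
  obtain b' a where i: "i = (b', a)" by (cases i)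
  show ?thesis
    using assms finite_J unfolding i row_act_def
    by (subst sum_row_state)
       (auto simp: digit_mat_def row_state_def word_row_def idx_def of_bool_def if_distrib[of "\<lambda>y. _ * y"]
          simp del: times_divide_eq_left cong: if_cong split: option.splits)
qed

lemma digit_act_test:
  assumes "Suc b = t" "i \<in> idx"
  shows "digit_act \<phi> N 0 (row_state \<phi> N b p u) i = row_state \<phi> N t (p * word_value \<phi> N u) [] i"
proof -
  obtain b' a where i: "i = (b', a)" by (cases i)
  show ?thesis
    using assms unfolding i row_act_def
    by (subst sum_row_state)
       (auto simp: digit_mat_def row_state_def test_col_def word_value_def test_def
          sum_divide_distrib mult_ac)
qed

text \<open>More than \<open>t\<close> consecutive zeros code nothing; their target index
  \<open>Suc t\<close> lies outside \<open>idx\<close>, so the row dies.\<close>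

lemma digit_act_overflow:
  assumes "i \<in> idx"
  shows "digit_act \<phi> N 0 (row_state \<phi> N t p u) i = 0"
proof -
  obtain b' a where i: "i = (b', a)" by (cases i)
  show ?thesis
    using assms unfolding i row_act_def
    by (subst sum_row_state) (auto simp: digit_mat_def idx_def)
qed

lemma digit_act_letter:
  assumes "b < t" "d \<noteq> 0" "i \<in> idx"
  shows "digit_act \<phi> N d (row_state \<phi> N b p u) i = row_state \<phi> N 0 p (u @ [b]) i"
proof -
  obtain b' a where i: "i = (b', a)" by (cases i)
  show ?thesis
    using assms t_pos unfolding i row_act_def
    by (subst sum_row_state)
       (auto simp: digit_mat_def row_state_def word_row_def letter_mat_def feature_snoc
          sum_divide_distrib mult_ac split: option.splits)
qed

lemma digit_act_restart:
  assumes "d \<noteq> 0" "i \<in> idx"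
  shows "digit_act \<phi> N d (row_state \<phi> N t p u) i = row_state \<phi> N 0 p [] i"
proof -
  obtain b' a where i: "i = (b', a)" by (cases i)
  show ?thesis
    using assms t_pos unfolding i row_act_def
    by (subst sum_row_state)
       (auto simp: digit_mat_def row_state_def word_row_def init_row_def feature_def split: option.splits)
qed

lemma init_vec_eq: "init_vec \<phi> N i = row_state \<phi> N 0 1 [] i"
  using t_pos by (auto simp: init_vec_def row_state_def init_row_def word_row_def feature_def
      split: option.splits prod.splits)

section \<open>Runs over digit words\<close>

definition leads :: "('j \<Rightarrow> int) \<Rightarrow> nat \<Rightarrow> nat list \<Rightarrow> (nat \<times> 'j option \<Rightarrow> real) \<Rightarrow> (nat \<times> 'j option \<Rightarrow> real) \<Rightarrow> bool" where
  "leads \<phi> N ds x y \<longleftrightarrow> (\<forall>i\<in>idx. foldl (\<lambda>x d. digit_act \<phi> N d x) x ds i = y i)"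

lemma leads_Nil: "leads \<phi> N [] x x"
  by (simp add: leads_def)

text \<open>Agreement on \<open>idx\<close> is enough to continue a run, because
  \<open>row_act\<close> sums over \<open>idx\<close> only.\<close>

lemma leads_append:
  assumes "leads \<phi> N ds x y" "leads \<phi> N es y z"
  shows "leads \<phi> N (ds @ es) x z"
proof -
  have "\<forall>i\<in>idx. x i = y i \<Longrightarrow>
    \<forall>i\<in>idx. foldl (\<lambda>x d. digit_act \<phi> N d x) x es i = foldl (\<lambda>x d. digit_act \<phi> N d x) y es i" for x y
    by (cases es) (simp_all add: row_act_cong[of idx x y])
  from this[of "foldl (\<lambda>x d. digit_act \<phi> N d x) x ds" y] show ?thesis
    using assms unfolding leads_def by simp
qed

lemma leads_single: "(\<And>i. i \<in> idx \<Longrightarrow> digit_act \<phi> N d x i = y i) \<Longrightarrow> leads \<phi> N [d] x y"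
  by (simp add: leads_def)

lemma leads_shift: "m < t \<Longrightarrow> leads \<phi> N (replicate m 0) (row_state \<phi> N 0 p u) (row_state \<phi> N m p u)"
proof (induction m)
  case (Suc m)
  then have "leads \<phi> N (replicate m 0 @ [0]) (row_state \<phi> N 0 p u) (row_state \<phi> N (Suc m) p u)"
    by (intro leads_append[OF _ leads_single[OF digit_act_shift]]) auto
  then show ?case by (simp add: replicate_append_same)
qed (simp add: leads_Nil)

text \<open>The digits 0 and 1 exist in every base. Every block ends in 1, so a concatenation of
  blocks is a standard representation.\<close>

definition word_digits :: "nat list \<Rightarrow> nat list" where
  "word_digits u = concat (map (\<lambda>d. replicate d 0 @ [1]) u) @ replicate t 0 @ [1]"

lemma leads_word:
  assumes "set u \<subseteq> {..<t}"
  shows "leads \<phi> N (word_digits u) (row_state \<phi> N 0 p []) (row_state \<phi> N 0 (p * word_value \<phi> N u) [])"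
proof -
  have "leads \<phi> N (concat (map (\<lambda>d. replicate d 0 @ [1]) u)) (row_state \<phi> N 0 p []) (row_state \<phi> N 0 p u)"
    using assms
  proof (induction u rule: rev_induct)
    case (snoc d u)
    then show ?case
      by (auto intro!: leads_append[of _ _ _ _ "row_state \<phi> N 0 p u"]
          leads_append[OF leads_shift] leads_single digit_act_letter)
  qed (simp add: leads_Nil)
  moreover have "leads \<phi> N (replicate t 0) (row_state \<phi> N 0 p u) (row_state \<phi> N t (p * word_value \<phi> N u) [])"
  proof -
    \<comment> \<open>The first \<open>t - 1\<close> zeros only count; the last one triggers the
      test.\<close>
    have "leads \<phi> N (replicate (t - 1) 0 @ [0]) (row_state \<phi> N 0 p u) (row_state \<phi> N t (p * word_value \<phi> N u) [])"
      using t_pos by (intro leads_append[OF leads_shift leads_single[OF digit_act_test]]) auto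
    then show ?thesis using t_pos by (simp add: replicate_append_same flip: replicate_Suc)
  qed
  moreover have "leads \<phi> N [1] (row_state \<phi> N t (p * word_value \<phi> N u) []) (row_state \<phi> N 0 (p * word_value \<phi> N u) [])"
    by (intro leads_single digit_act_restart) auto
  ultimately show ?thesis
    unfolding word_digits_def by (blast intro: leads_append)
qed

lemma leads_word_power:
  assumes "set u \<subseteq> {..<t}"
  shows "leads \<phi> N (concat (replicate m (word_digits u))) (row_state \<phi> N 0 1 []) (row_state \<phi> N 0 (word_value \<phi> N u ^ m) [])"
proof (induction m)
  case (Suc m)
  have "leads \<phi> N (concat (replicate m (word_digits u)) @ word_digits u) (row_state \<phi> N 0 1 [])
     (row_state \<phi> N 0 (word_value \<phi> N u ^ m * word_value \<phi> N u) [])"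
    by (rule leads_append[OF Suc leads_word[OF assms]])
  moreover have "concat (replicate m (word_digits u)) @ word_digits u = concat (replicate (Suc m) (word_digits u))"
    by (simp only: replicate_Suc flip: replicate_append_same) simp
  ultimately show ?case by (simp add: mult.commute)
qed (simp add: leads_Nil)

definition digit_output :: "('j \<Rightarrow> int) \<Rightarrow> nat \<Rightarrow> nat list \<Rightarrow> real" where
  "digit_output \<phi> N ds = foldl (\<lambda>x d. digit_act \<phi> N d x) (init_vec \<phi> N) ds (0, None)"

lemma output_leads:
  "leads \<phi> N ds (row_state \<phi> N 0 1 []) (row_state \<phi> N 0 p u) \<Longrightarrow> digit_output \<phi> N ds = p"
  using t_pos by (simp add: leads_def digit_output_def idx_def init_vec_eq[abs_def] row_state_def word_row_def)

text \<open>Repeating the word \<open>m\<close> times produces the \<open>m\<close>-th power of a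
  number above 1, at an index with \<open>m\<close> times as many digits.\<close>

lemma output_growth:
  assumes k: "k \<ge> 2" and u: "set u \<subseteq> {..<t}" and "test \<phi> u > 0" and N: "N > 0"
  shows "has_poly_growth (\<lambda>n. digit_output \<phi> N (digits k n))"
proof -
  let ?ds = "\<lambda>m. concat (replicate m (word_digits u))"
  have dig: "\<forall>d\<in>set (?ds m). d < k" for m
    using k by (auto simp: word_digits_def)
  have len: "length (?ds m) = m * length (word_digits u)" for m
    by (induction m) auto
  have last: "m = 0 \<or> (?ds m \<noteq> [] \<and> last (?ds m) \<noteq> 0)" for m
    by (induction m) (auto simp: word_digits_def)
  have pos: "length (word_digits u) > 0" by (simp add: word_digits_def)
  show ?thesis
  proof (rule has_poly_growthI[of "word_value \<phi> N u" "real k ^ length (word_digits u)" "\<lambda>m. of_digits k (?ds m)"])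
    show "word_value \<phi> N u > 1"
      using assms C_pos by (simp add: word_value_def)
    show "real k ^ length (word_digits u) > 1"
      using k pos by (intro one_less_power) auto
    show "m \<le> of_digits k (?ds m)" for m
    proof (cases m)
      case (Suc m')
      have "m * 1 \<le> m * length (word_digits u)" using pos by (intro mult_le_mono2) linarith
      also have "\<dots> = length (?ds m)" by (rule len[symmetric])
      also have "\<dots> \<le> of_digits k (?ds m)"
        using last[of m] Suc by (intro of_digits_ge k) auto
      finally show ?thesis by simp
    qed simp
    show "real (of_digits k (?ds m)) \<le> (real k ^ length (word_digits u)) ^ m" for m
    proof -
      have "of_digits k (?ds m) \<le> k ^ (length (word_digits u) * m)"
        using of_digits_less[OF k dig, of m] by (simp add: len mult.commute)
      then have "real (of_digits k (?ds m)) \<le> real (k ^ (length (word_digits u) * m))"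
        by (simp only: of_nat_le_iff)
      then show ?thesis by (simp add: power_mult)
    qed
    show "digit_output \<phi> N (digits k (of_digits k (?ds m))) = word_value \<phi> N u ^ m" for m
    proof -
      have "digits k (of_digits k (?ds m)) = ?ds m"
        using last[of m] by (intro digits_of_digits k dig) auto
      then show ?thesis
        using output_leads[OF leads_word_power[OF u]] by simp
    qed
  qed
qed

section \<open>Boundedness if no word has a positive test\<close>

definition bounded_row :: "('j \<Rightarrow> int) \<Rightarrow> nat \<Rightarrow> (nat \<times> 'j option \<Rightarrow> real) \<Rightarrow> bool" where
  "bounded_row \<phi> N x \<longleftrightarrow> (\<forall>i\<in>idx. x i = 0) \<or>
     (\<exists>b p u. b \<le> t \<and> \<bar>p\<bar> \<le> 1 \<and> set u \<subseteq> {..<t} \<and> (\<forall>i\<in>idx. x i = row_state \<phi> N b p u i))"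

text \<open>All digit strings must be covered, including unfinished words and those with too many
  zeros; the latter lead to the zero row.\<close>

lemma bounded_row_digit_act:
  assumes val: "\<And>u. set u \<subseteq> {..<t} \<Longrightarrow> \<bar>word_value \<phi> N u\<bar> \<le> 1" and "bounded_row \<phi> N x"
  shows "bounded_row \<phi> N (digit_act \<phi> N d x)"
proof -
  consider "\<forall>i\<in>idx. x i = 0" | b p u where "b \<le> t" "\<bar>p\<bar> \<le> 1" "set u \<subseteq> {..<t}" "\<forall>i\<in>idx. x i = row_state \<phi> N b p u i"
    using assms(2) unfolding bounded_row_def by blast
  then show ?thesis
  proof cases
    case 1
    then show ?thesis unfolding bounded_row_def row_act_def by simp
  next
    case 2
    have x: "digit_act \<phi> N d x = digit_act \<phi> N d (row_state \<phi> N b p u)"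
      using 2 by (intro row_act_cong) auto
    have p: "\<bar>p * word_value \<phi> N u\<bar> \<le> 1"
      using 2 val[of u] by (simp add: abs_mult mult_le_one)
    consider "d = 0" "Suc b < t" | "d = 0" "Suc b = t" | "d = 0" "b = t" | "d \<noteq> 0" "b < t" | "d \<noteq> 0" "b = t"
      using \<open>b \<le> t\<close> by linarith
    then show ?thesis
    proof cases
      case 1
      then show ?thesis unfolding x bounded_row_def using 2 digit_act_shift[of b]
        by (intro disjI2 exI[of _ "Suc b"] exI[of _ p] exI[of _ u]) auto
    next
      case 2
      then show ?thesis unfolding x bounded_row_def using p digit_act_test[of b]
        by (intro disjI2 exI[of _ t] exI[of _ "p * word_value \<phi> N u"] exI[of _ "[]"]) auto
    next
      case 3
      then show ?thesis unfolding x bounded_row_def using digit_act_overflow by blast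
    next
      case 4
      then show ?thesis unfolding x bounded_row_def using 2 digit_act_letter[of b d]
        by (intro disjI2 exI[of _ 0] exI[of _ p] exI[of _ "u @ [b]"]) auto
    next
      case 5
      then show ?thesis unfolding x bounded_row_def using 2 digit_act_restart[of d]
        by (intro disjI2 exI[of _ 0] exI[of _ p] exI[of _ "[]"]) auto
    qed
  qed
qed

text \<open>By the choice of \<open>C\<close> and \<open>N\<close> a test that is not positive
  contributes a quotient between -1 and 0, so every factor of the product lies between 0 and
  1.\<close>

lemma output_bounded:
  assumes \<phi>: "\<And>l. l \<in> J \<Longrightarrow> \<bar>\<phi> l\<bar> \<le> int N" and N: "N > 0"
    and neg: "\<And>u. set u \<subseteq> {..<t} \<Longrightarrow> test \<phi> u \<le> 0"
  shows "\<bar>digit_output \<phi> N ds\<bar> \<le> 1"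
proof -
  have val: "\<bar>word_value \<phi> N u\<bar> \<le> 1" if u: "set u \<subseteq> {..<t}" for u
  proof -
    let ?D = "real (N * C ^ Suc (length u))"
    have D: "?D > 0" using N C_pos by simp
    have "\<bar>test \<phi> u\<bar> \<le> int (N * C ^ Suc (length u))" using test_bound[OF \<phi> u] .
    then have "\<bar>real_of_int (test \<phi> u)\<bar> \<le> ?D"
      by (metis of_int_abs of_int_le_iff of_int_of_nat_eq)
    then have "\<bar>real_of_int (test \<phi> u) / ?D\<bar> \<le> 1" using D by (simp add: abs_divide divide_le_eq)
    moreover have "real_of_int (test \<phi> u) / ?D \<le> 0"
      using neg[OF u] D by (simp add: divide_nonpos_pos)
    ultimately show ?thesis unfolding word_value_def by linarith
  qed
  have "bounded_row \<phi> N (init_vec \<phi> N)"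
    unfolding bounded_row_def
    by (intro disjI2 exI[of _ 0] exI[of _ 1] exI[of _ "[]"]) (auto simp: init_vec_eq)
  then have "bounded_row \<phi> N (foldl (\<lambda>x d. digit_act \<phi> N d x) (init_vec \<phi> N) ds)"
    by (induction ds rule: rev_induct) (auto intro: bounded_row_digit_act[OF val])
  moreover have "(0, None) \<in> idx" by (simp add: idx_def)
  ultimately show ?thesis
    unfolding bounded_row_def digit_output_def
    by (auto simp: row_state_def word_row_def)
qed

theorem output_growth_iff:
  assumes "k \<ge> 2" "\<And>l. l \<in> J \<Longrightarrow> \<bar>\<phi> l\<bar> \<le> int N" "N > 0"
  shows "has_poly_growth (\<lambda>n. digit_output \<phi> N (digits k n)) \<longleftrightarrow> (\<exists>u. set u \<subseteq> {..<t} \<and> test \<phi> u > 0)"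
  using output_growth[OF assms(1)] output_bounded[of \<phi> N] not_has_poly_growth_bounded assms
  by (meson not_le_imp_less)

lemma of_rat_digit_mat: "of_rat (digit_mat \<phi> N d i j) = (digit_mat \<phi> N d i j :: real)"
  by (auto simp: digit_mat_def test_col_def letter_mat_def init_row_def of_rat_divide
      split: prod.splits option.splits)

lemma of_rat_init_vec: "of_rat (init_vec \<phi> N i) = (init_vec \<phi> N i :: real)"
  by (auto simp: init_vec_def init_row_def of_rat_divide split: prod.splits option.splits)

end

text \<open>The states may be of any kind, as long as their features transform linearly under every
  letter. The input \<open>n\<close> enters through the initial features alone, and their restricted
  form makes the representation computable from \<open>n\<close>.\<close>

lemma letter_system_reduction:
  fixes t :: nat and J :: "'j set" and \<phi> :: "'s \<Rightarrow> 'j \<Rightarrow> int" and init :: "nat \<Rightarrow> 's"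
  assumes k: "k \<ge> 2" and S: "\<rat> \<subseteq> S" and t: "t > 0" and J: "finite J"
    and act: "\<And>d l s. d < t \<Longrightarrow> l \<in> J \<Longrightarrow> \<phi> (act d s) l = (\<Sum>j\<in>J. \<phi> s j * A d j l)"
    and init: "\<And>l. l \<in> J \<Longrightarrow> (\<lambda>n. \<phi> (init n) l) \<in> {\<lambda>_. 0, \<lambda>_. 1, int, \<lambda>n. int n * int n}"
  shows "\<exists>L. (\<forall>n. valid_linrep k S (L n)) \<and> recursive (\<lambda>n. enc_linrep (L n)) \<and>
     (\<forall>n. has_poly_growth (linrep_seq k (L n)) \<longleftrightarrow>
       (\<exists>u. set u \<subseteq> {..<t} \<and> (\<Sum>j\<in>J. \<phi> (foldl (\<lambda>s d. act d s) (init n) u) j * \<tau> j) > 0))"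
proof -
  \<comment> \<open>A crude common bound for all column sums; the summand 1 makes it
    positive.\<close>
  define C where "C = nat (1 + (\<Sum>d<t. \<Sum>l\<in>J. \<Sum>j\<in>J. \<bar>A d j l\<bar>) + (\<Sum>j\<in>J. \<bar>\<tau> j\<bar>))"
  have nonneg: "0 \<le> (\<Sum>d<t. \<Sum>l\<in>J. \<Sum>j\<in>J. \<bar>A d j l\<bar>)" "0 \<le> (\<Sum>j\<in>J. \<bar>\<tau> j\<bar>)"
    by (intro sum_nonneg; simp)+
  have A_le: "(\<Sum>j\<in>J. \<bar>A d j l\<bar>) \<le> (\<Sum>d<t. \<Sum>l\<in>J. \<Sum>j\<in>J. \<bar>A d j l\<bar>)" if "d < t" "l \<in> J" for d l
  proof -
    have "(\<Sum>j\<in>J. \<bar>A d j l\<bar>) \<le> (\<Sum>l\<in>J. \<Sum>j\<in>J. \<bar>A d j l\<bar>)"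
      using that J by (intro member_le_sum[of l J "\<lambda>l. \<Sum>j\<in>J. \<bar>A d j l\<bar>"]) (auto intro: sum_nonneg)
    also have "\<dots> \<le> (\<Sum>d<t. \<Sum>l\<in>J. \<Sum>j\<in>J. \<bar>A d j l\<bar>)"
      using that by (intro member_le_sum[of d "{..<t}" "\<lambda>d. \<Sum>l\<in>J. \<Sum>j\<in>J. \<bar>A d j l\<bar>"]) (auto intro: sum_nonneg)
    finally show ?thesis .
  qed
  interpret letter_system t J A \<tau> C
  proof
    have C: "int C = 1 + (\<Sum>d<t. \<Sum>l\<in>J. \<Sum>j\<in>J. \<bar>A d j l\<bar>) + (\<Sum>j\<in>J. \<bar>\<tau> j\<bar>)"
      unfolding C_def using nonneg by (intro nat_0_le) linarith
    show "C > 0" using C nonneg by linarith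
    show "(\<Sum>j\<in>J. \<bar>A d j l\<bar>) \<le> int C" if "d < t" "l \<in> J" for d l
      using C nonneg(2) A_le[OF that] by linarith
    show "(\<Sum>j\<in>J. \<bar>\<tau> j\<bar>) \<le> int C" using C nonneg(1) by linarith
  qed (use t J in auto)
  \<comment> \<open>\<open>(n + 1) * (n + 1)\<close> dominates 0, 1, \<open>n\<close> and
    \<open>n * n\<close>, and it is coprime to the last three.\<close>
  define N where "N n = (n + 1) * (n + 1)" for n :: nat
  obtain r and h :: "nat \<Rightarrow> nat \<times> 'j option" where h: "bij_betw h {..<r} idx"
    using ex_bij_betw_nat_finite[OF finite_idx] by (auto simp: atLeast0LessThan)
  define L where "L n = rat_linrep k r (\<lambda>i. init_vec (\<phi> (init n)) (N n) (h i)) (\<lambda>i. final_vec (h i))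
    (\<lambda>d i j. digit_mat (\<phi> (init n)) (N n) d (h i) (h j))" for n
  have "valid_linrep k S (L n)" for n
    unfolding L_def by (rule valid_rat_linrep[OF S])
  moreover have "recursive (\<lambda>n. enc_linrep (L n))"
  proof -
    have const: "recursive (\<lambda>n. enc_alg (rat_rep q))" for q by (rule recursive_const)
    \<comment> \<open>The case distinctions in \<open>init_vec\<close> and \<open>digit_mat\<close>
      do not depend on \<open>n\<close>, so every entry is either a constant or an entry of
      \<open>init_row\<close>.\<close>
    have ifI: "recursive (\<lambda>n. enc_alg (rat_rep (if b then F n else G n)))"
      if "recursive (\<lambda>n. enc_alg (rat_rep (F n)))" "recursive (\<lambda>n. enc_alg (rat_rep (G n)))" for b F G
      using that by (cases b) simp_all
    have "recursive N"
      unfolding N_def[abs_def] by (intro recursive_mult recursive_add recursive_id recursive_const)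
    moreover have "N n > 0" for n by (simp add: N_def)
    ultimately have N: "recursive N" "\<And>n. N n > 0" by blast+
    have cop: "coprime n (N n)" "coprime (n * n) (N n)" for n
    proof -
      have "coprime n (n + 1)" by simp
      then show "coprime n (N n)" "coprime (n * n) (N n)"
        by (simp_all only: N_def coprime_mult_left_iff coprime_mult_right_iff)
    qed
    have row: "recursive (\<lambda>n. enc_alg (rat_rep (init_row (\<phi> (init n)) (N n) a)))"
      if "a \<in> insert None (Some ` J)" for a
    proof (cases a)
      case None
      then show ?thesis by (simp add: init_row_def const)
    next
      case (Some l)
      with that have "l \<in> J" by auto
      then have "(\<lambda>n. \<phi> (init n) l) \<in> {\<lambda>_. 0, \<lambda>_. 1, int, \<lambda>n. int n * int n}" by (rule init)
      \<comment> \<open>The numerator 0 is not coprime to \<open>N n\<close> for positive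
        \<open>n\<close>, but then the entry is constant.\<close>
      then obtain a where a: "\<And>n. \<phi> (init n) l = int (a n)" "recursive a"
        "(\<forall>n. coprime (a n) (N n)) \<or> a = (\<lambda>_. 0)"
      proof (elim insertE emptyE)
        assume "(\<lambda>n. \<phi> (init n) l) = (\<lambda>_. 0)"
        then show thesis using that[of "\<lambda>_. 0"] by (auto simp: fun_eq_iff recursive_const)
      next
        assume "(\<lambda>n. \<phi> (init n) l) = (\<lambda>_. 1)"
        then show thesis using that[of "\<lambda>_. 1"] by (auto simp: fun_eq_iff recursive_const)
      next
        assume "(\<lambda>n. \<phi> (init n) l) = int"
        then show thesis using that[of "\<lambda>n. n"] cop by (auto simp: fun_eq_iff recursive_id)
      next
        assume "(\<lambda>n. \<phi> (init n) l) = (\<lambda>n. int n * int n)"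
        then show thesis
          by (intro that[of "\<lambda>n. n * n"])
             (use cop in \<open>auto simp: fun_eq_iff intro!: recursive_mult recursive_id\<close>)
      qed
      from a(3) show ?thesis
      proof
        assume "\<forall>n. coprime (a n) (N n)"
        then show ?thesis
          using recursive_enc_fraction[OF a(2) N] by (simp add: Some init_row_def a(1))
      next
        assume "a = (\<lambda>_. 0)"
        then show ?thesis by (simp add: Some init_row_def a(1) const)
      qed
    qed
    have hi: "snd (h i) \<in> insert None (Some ` J)" if "i < r" for i
      using h that unfolding bij_betw_def idx_def by (auto simp: image_iff dest!: equalityD1)
    have "recursive (\<lambda>n. enc_alg (rat_rep (init_vec (\<phi> (init n)) (N n) (h i))))" if "i < r" for i
      unfolding init_vec_def split_beta by (intro ifI row[OF hi[OF that]] const)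
    moreover have "recursive (\<lambda>n. enc_alg (rat_rep (digit_mat (\<phi> (init n)) (N n) d (h i) (h j))))"
      if "i < r" "j < r" for d i j
      unfolding digit_mat_def split_beta by (intro ifI row[OF hi[OF that(2)]] const)
    ultimately show ?thesis
      unfolding L_def by (intro recursive_enc_rat_linrep const)
  qed
  moreover have "has_poly_growth (linrep_seq k (L n)) \<longleftrightarrow>
       (\<exists>u. set u \<subseteq> {..<t} \<and> (\<Sum>j\<in>J. \<phi> (foldl (\<lambda>s d. act d s) (init n) u) j * \<tau> j) > 0)" for n
  proof -
    have "linrep_seq k (L n) m = digit_output (\<phi> (init n)) (N n) (digits k m)" for m
    proof -
      have "linrep_seq k (L n) m = (\<Sum>j\<in>idx. foldl (\<lambda>x d. digit_act (\<phi> (init n)) (N n) d x)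
          (init_vec (\<phi> (init n)) (N n)) (digits k m) j * of_bool (j = (0, None)))"
        unfolding L_def linrep_seq_rat_linrep[OF k h] of_rat_digit_mat of_rat_init_vec
        by (intro sum.cong refl) (simp add: final_vec_def)
      also have "\<dots> = digit_output (\<phi> (init n)) (N n) (digits k m)"
        using finite_idx by (simp add: digit_output_def idx_def of_bool_def if_distrib cong: if_cong)
      finally show ?thesis .
    qed
    then have seq: "linrep_seq k (L n) = (\<lambda>m. digit_output (\<phi> (init n)) (N n) (digits k m))" by blast
    have bound: "\<bar>\<phi> (init n) l\<bar> \<le> int (N n)" if "l \<in> J" for l
      using init[OF that] unfolding N_def by (auto simp: fun_eq_iff algebra_simps)
    have "feature (\<phi> (init n)) u l = \<phi> (foldl (\<lambda>s d. act d s) (init n) u) l"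
      if "set u \<subseteq> {..<t}" "l \<in> J" for u l
      using that by (induction u arbitrary: l rule: rev_induct) (simp_all add: feature_snoc act, simp add: feature_def)
    then have test: "test (\<phi> (init n)) u = (\<Sum>j\<in>J. \<phi> (foldl (\<lambda>s d. act d s) (init n) u) j * \<tau> j)"
      if "set u \<subseteq> {..<t}" for u
      unfolding test_def using that by simp
    have "N n > 0" by (simp add: N_def)
    with output_growth_iff[OF k bound] show ?thesis
      unfolding seq using test by auto
  qed
  ultimately show ?thesis by blast
qed

section \<open>Rewriting by registers\<close>

text \<open>Closure properties of this set show that a letter acts by an integer matrix without
  writing the matrix down.\<close>

definition span_of :: "'i set \<Rightarrow> ('s \<Rightarrow> 'i \<Rightarrow> int) \<Rightarrow> ('s \<Rightarrow> int) set" where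
  "span_of I x = {f. \<exists>c. \<forall>s. f s = (\<Sum>i\<in>I. x s i * c i)}"

lemma span_of_add: "f \<in> span_of I x \<Longrightarrow> g \<in> span_of I x \<Longrightarrow> (\<lambda>s. f s + g s) \<in> span_of I x"
  unfolding span_of_def
proof clarify
  fix c d assume "\<forall>s. f s = (\<Sum>i\<in>I. x s i * c i)" "\<forall>s. g s = (\<Sum>i\<in>I. x s i * d i)"
  then show "\<exists>e. \<forall>s. f s + g s = (\<Sum>i\<in>I. x s i * e i)"
    by (intro exI[of _ "\<lambda>i. c i + d i"]) (simp add: distrib_left sum.distrib)
qed

lemma span_of_cmult: "f \<in> span_of I x \<Longrightarrow> (\<lambda>s. f s * a) \<in> span_of I x"
  unfolding span_of_def
proof clarify
  fix c assume "\<forall>s. f s = (\<Sum>i\<in>I. x s i * c i)"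
  then show "\<exists>e. \<forall>s. f s * a = (\<Sum>i\<in>I. x s i * e i)"
    by (intro exI[of _ "\<lambda>i. c i * a"]) (simp add: sum_distrib_right mult.assoc)
qed

lemma span_of_diff: "f \<in> span_of I x \<Longrightarrow> g \<in> span_of I x \<Longrightarrow> (\<lambda>s. f s - g s) \<in> span_of I x"
  using span_of_add[OF _ span_of_cmult[of g I x "- 1"]] by simp

lemma span_of_zero: "(\<lambda>s. 0) \<in> span_of I x"
  unfolding span_of_def by (auto intro!: exI[of _ "\<lambda>_. 0"])

lemma span_of_base: "finite I \<Longrightarrow> i \<in> I \<Longrightarrow> (\<lambda>s. x s i) \<in> span_of I x"
  unfolding span_of_def
  by (auto intro!: exI[of _ "\<lambda>j. if j = i then 1 else 0"] simp: if_distrib cong: if_cong)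

lemma span_of_sum: "(\<And>e. e \<in> E \<Longrightarrow> f e \<in> span_of I x) \<Longrightarrow> (\<lambda>s. \<Sum>e\<in>E. f e s) \<in> span_of I x"
  by (induction E rule: infinite_finite_induct) (auto intro: span_of_zero span_of_add)

section \<open>Registers and local equations for expressions\<close>

text \<open>
  As \<open>prod_encode (a, b) = triangle (a + b) + a\<close>, a pair becomes a linear expression once \<open>a + b\<close> is
  available together with its triangular number; this is why \<open>Pls a b\<close> is added below \<open>Pr a b\<close> and
  why registers come with companions \<open>Tri e\<close>.
\<close>

fun subexs :: "ex \<Rightarrow> ex set" where
  "subexs (Var i) = {Var i}"
| "subexs (Cst c) = {Cst c}"
| "subexs (Pls a b) = insert (Pls a b) (subexs a \<union> subexs b)"
| "subexs (Pr a b) = {Pr a b, Pls a b} \<union> subexs a \<union> subexs b"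

lemma subexs_self: "e \<in> subexs e"
  by (cases e) auto

lemma finite_subexs: "finite (subexs e)"
  by (induction e) auto

lemma subexs_closed:
  "Pls a b \<in> subexs e \<Longrightarrow> a \<in> subexs e \<and> b \<in> subexs e"
  "Pr a b \<in> subexs e \<Longrightarrow> Pls a b \<in> subexs e"
  by (induction e) (auto simp: subexs_self)

text \<open>The constant register \<open>One\<close> turns affine expressions into linear
  ones.\<close>

datatype reg = One | Config | Reg ex | Tri ex
datatype feat = Penalty | Prod reg reg
datatype letter = Inc ex | Fire ex ex

type_synonym store = "int \<times> nat \<times> (ex \<Rightarrow> nat)"

fun reg_val :: "store \<Rightarrow> reg \<Rightarrow> int" where
  "reg_val (p, c, r) One = 1"
| "reg_val (p, c, r) Config = int c"
| "reg_val (p, c, r) (Reg e) = int (r e)"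
| "reg_val (p, c, r) (Tri e) = int (triangle (r e))"

fun feat_val :: "store \<Rightarrow> feat \<Rightarrow> int" where
  "feat_val s Penalty = fst s"
| "feat_val s (Prod i j) = reg_val s i * reg_val s j"

text \<open>The error in the local equation that links \<open>e\<close> to its immediate parts. A
  variable may take any value and has no equation.\<close>

fun defect :: "ex \<Rightarrow> store \<Rightarrow> int" where
  "defect (Var i) s = 0"
| "defect (Cst c) s = reg_val s (Reg (Cst c)) - reg_val s One * int c"
| "defect (Pls a b) s = reg_val s (Reg (Pls a b)) - reg_val s (Reg a) - reg_val s (Reg b)"
| "defect (Pr a b) s = reg_val s (Reg (Pr a b)) - reg_val s (Tri (Pls a b)) - reg_val s (Reg a)"

text \<open>The registers of the variables define a valuation, and the local equations propagate it
  to all compound expressions.\<close>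

lemma defect_zero_val:
  assumes "\<And>e. e \<in> X \<Longrightarrow> defect e (p, c, r) = 0"
    and "\<And>a b. Pls a b \<in> X \<Longrightarrow> a \<in> X \<and> b \<in> X" and "\<And>a b. Pr a b \<in> X \<Longrightarrow> Pls a b \<in> X"
    and "e \<in> X"
  shows "r e = val (\<lambda>i. r (Var i)) e"
  using assms(4)
proof (induction e)
  case (Cst x)
  then show ?case using assms(1)[of "Cst x"] by simp
next
  case (Pls a b)
  then show ?case using assms(1)[of "Pls a b"] assms(2)[of a b] by simp
next
  case (Pr a b)
  then have "Pls a b \<in> X" "a \<in> X" "b \<in> X" using assms(2,3) by blast+
  then have "int (r (Pls a b)) = int (r a) + int (r b)" 
    "int (r (Pr a b)) = int (triangle (r (Pls a b))) + int (r a)"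
    using assms(1)[of "Pls a b"] assms(1)[of "Pr a b"] Pr by simp_all
  then have "r (Pls a b) = r a + r b" "r (Pr a b) = triangle (r (Pls a b)) + r a"
    by linarith+
  then show ?case using Pr \<open>a \<in> X\<close> \<open>b \<in> X\<close> by (simp add: prod_encode_def)
qed simp

lemma defect_val:
  assumes r: "\<And>e. e \<in> X \<Longrightarrow> r e = val y e"
    and "\<And>a b. Pls a b \<in> X \<Longrightarrow> a \<in> X \<and> b \<in> X" and "\<And>a b. Pr a b \<in> X \<Longrightarrow> Pls a b \<in> X"
    and "e \<in> X"
  shows "defect e (p, c, r) = 0"
proof (cases e)
  case (Pls a b)
  then have "a \<in> X" "b \<in> X" "e \<in> X" using assms(2,4) by blast+
  then show ?thesis using r[of a] r[of b] r[of e] by (simp add: Pls)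
next
  case (Pr a b)
  then have "Pls a b \<in> X" "a \<in> X" "e \<in> X" using assms(2-4) by blast+
  then show ?thesis using r[of "Pls a b"] r[of a] r[of e] by (simp add: Pr prod_encode_def)
qed (use r[OF \<open>e \<in> X\<close>] in auto)

section \<open>Simulation of rewriting by letters\<close>

locale rule_system =
  fixes R :: "(ex \<times> ex) list"
begin

definition exs :: "ex set" where
  "exs = (\<Union>(P, Q) \<in> set R. subexs P \<union> subexs Q)"

lemma finite_exs: "finite exs"
  unfolding exs_def by (auto intro: finite_subexs)

lemma exs_closed:
  "Pls a b \<in> exs \<Longrightarrow> a \<in> exs \<and> b \<in> exs"
  "Pr a b \<in> exs \<Longrightarrow> Pls a b \<in> exs"
  unfolding exs_def using subexs_closed by fast+

lemma rule_in_exs: "(P, Q) \<in> set R \<Longrightarrow> P \<in> exs" "(P, Q) \<in> set R \<Longrightarrow> Q \<in> exs"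
  unfolding exs_def using subexs_self by fast+

text \<open>A sum of squares vanishes only if every equation holds, and it can never cancel an
  earlier penalty.\<close>

definition guard :: "ex \<Rightarrow> store \<Rightarrow> int" where
  "guard P s = (\<Sum>e\<in>exs. defect e s * defect e s) +
     (reg_val s Config - reg_val s (Reg P)) * (reg_val s Config - reg_val s (Reg P))"

text \<open>\<open>Fire\<close> never blocks: wrong guesses only raise the penalty, so each letter
  acts by the same formula on all stores. Clearing the registers prepares fresh guesses for the next
  step.\<close>

fun act :: "letter \<Rightarrow> store \<Rightarrow> store" where
  "act (Inc e) (p, c, r) = (p, c, r(e := Suc (r e)))"
| "act (Fire P Q) (p, c, r) = (p + guard P (p, c, r), r Q, \<lambda>_. 0)"

definition letters :: "letter set" where
  "letters = Inc ` exs \<union> (\<lambda>(P, Q). Fire P Q) ` set R"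

definition run :: "letter list \<Rightarrow> store \<Rightarrow> store" where
  "run u s = foldl (\<lambda>s d. act d s) s u"

lemma guard_nonneg: "guard P s \<ge> 0"
  unfolding guard_def by (intro add_nonneg_nonneg sum_nonneg) auto

lemma guard_zero_iff:
  "guard P s = 0 \<longleftrightarrow> (\<forall>e\<in>exs. defect e s = 0) \<and> reg_val s Config = reg_val s (Reg P)"
proof -
  have "guard P s = 0 \<longleftrightarrow> (\<Sum>e\<in>exs. defect e s * defect e s) = 0 \<and>
     (reg_val s Config - reg_val s (Reg P)) * (reg_val s Config - reg_val s (Reg P)) = 0"
    unfolding guard_def by (intro add_nonneg_eq_0_iff sum_nonneg) auto
  then show ?thesis by (simp add: sum_nonneg_eq_0_iff finite_exs)
qed

text \<open>The penalty never decreases, so a final penalty of 0 means that every guard passed on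
  the way was 0.\<close>

lemma run_sound:
  assumes "set u \<subseteq> letters" "run u (0, n, \<lambda>_. 0) = (p, c, r)"
  shows "p \<ge> 0 \<and> (p = 0 \<longrightarrow> (step (set R))\<^sup>*\<^sup>* n c)"
  using assms
proof (induction u arbitrary: p c r rule: rev_induct)
  case Nil
  then show ?case by (simp add: run_def)
next
  case (snoc d u)
  obtain p' c' r' where s: "run u (0, n, \<lambda>_. 0) = (p', c', r')" by (cases "run u (0, n, \<lambda>_. 0)")
  have IH: "p' \<ge> 0" "p' = 0 \<Longrightarrow> (step (set R))\<^sup>*\<^sup>* n c'"
    using snoc.IH[OF _ s] snoc.prems by auto
  have run: "act d (p', c', r') = (p, c, r)"
    using snoc.prems(2) s by (simp add: run_def)
  show ?case
  proof (cases d)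
    case (Inc e)
    then show ?thesis using run IH by auto
  next
    case (Fire P Q)
    then have rule: "(P, Q) \<in> set R" using snoc.prems(1) unfolding letters_def by auto
    have p: "p = p' + guard P (p', c', r')" and c: "c = r' Q"
      using run Fire by auto
    have "(step (set R))\<^sup>*\<^sup>* n c" if "p = 0"
    proof -
      have "p' = 0" "guard P (p', c', r') = 0"
        using that p IH(1) guard_nonneg[of P "(p', c', r')"] by linarith+
      then have "\<forall>e\<in>exs. defect e (p', c', r') = 0" "c' = r' P"
        by (auto simp: guard_zero_iff)
      then have "r' e = val (\<lambda>i. r' (Var i)) e" if "e \<in> exs" for e
        by (intro defect_zero_val[OF _ exs_closed that]) auto
      then have "r' P = val (\<lambda>i. r' (Var i)) P" "r' Q = val (\<lambda>i. r' (Var i)) Q"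
        using rule_in_exs[OF rule] by blast+
      then have "step (set R) c' c"
        using rule \<open>c' = r' P\<close> c unfolding step_def by blast
      with IH(2)[OF \<open>p' = 0\<close>] show ?thesis by simp
    qed
    then show ?thesis using p IH(1) guard_nonneg[of P "(p', c', r')"] by simp
  qed
qed

lemma run_append: "run (u @ v) s = run v (run u s)"
  by (simp add: run_def)

lemma run_Inc: "run (replicate m (Inc e)) (p, c, r) = (p, c, r(e := r e + m))"
  by (induction m arbitrary: r) (simp_all add: run_def)

lemma run_Incs:
  "distinct es \<Longrightarrow> run (concat (map (\<lambda>e. replicate (f e) (Inc e)) es)) (p, c, r) =
     (p, c, \<lambda>e. r e + (if e \<in> set es then f e else 0))"
proof (induction es arbitrary: r)
  case (Cons a es)
  then show ?case by (auto simp: run_append run_Inc fun_eq_iff)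
qed (simp add: run_def)

text \<open>Before each \<open>Fire\<close>, all expressions in \<open>exs\<close> are counted up to
  their values, including those of other rules, because \<open>guard\<close> checks them
  all.\<close>

lemma run_complete:
  "(step (set R))\<^sup>*\<^sup>* n c \<Longrightarrow> \<exists>u. set u \<subseteq> letters \<and> run u (0, n, \<lambda>_. 0) = (0, c, \<lambda>_. 0)"
proof (induction rule: rtranclp_induct)
  case base
  then show ?case by (intro exI[of _ "[]"]) (simp add: run_def)
next
  case (step c c')
  then obtain u where u: "set u \<subseteq> letters" "run u (0, n, \<lambda>_. 0) = (0, c, \<lambda>_. 0)" by blast
  from step.hyps(2) obtain P Q y where rule: "(P, Q) \<in> set R" and c: "c = val y P" "c' = val y Q"
    unfolding step_def by blast
  obtain es where es: "set es = exs" "distinct es"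
    using finite_distinct_list[OF finite_exs] by blast
  define v where "v = concat (map (\<lambda>e. replicate (val y e) (Inc e)) es)"
  define r where "r e = (if e \<in> exs then val y e else 0)" for e
  have v: "run v (0, c, \<lambda>_. 0) = (0, c, r)"
    unfolding v_def r_def by (simp add: run_Incs es)
  have P: "r P = val y P" "r Q = val y Q"
    using rule_in_exs[OF rule] by (simp_all add: r_def)
  have "defect e (0, c, r) = 0" if "e \<in> exs" for e
    by (rule defect_val[OF _ exs_closed that]) (simp_all add: r_def)
  then have "guard P (0, c, r) = 0"
    by (simp add: guard_zero_iff P c)
  then have "run (u @ v @ [Fire P Q]) (0, n, \<lambda>_. 0) = (0, c', \<lambda>_. 0)"
    unfolding run_append u v by (simp add: run_def P c)
  moreover have "set (u @ v @ [Fire P Q]) \<subseteq> letters"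
    using u es rule by (auto simp: v_def letters_def)
  ultimately show ?case by blast
qed

section \<open>Linearity of the feature updates\<close>

definition regs :: "reg set" where
  "regs = {One, Config} \<union> Reg ` exs \<union> Tri ` exs"

definition feats :: "feat set" where
  "feats = insert Penalty ((\<lambda>(i, j). Prod i j) ` (regs \<times> regs))"

lemma regs_iff [simp]:
  "One \<in> regs" "Config \<in> regs" "Reg e \<in> regs \<longleftrightarrow> e \<in> exs" "Tri e \<in> regs \<longleftrightarrow> e \<in> exs"
  by (auto simp: regs_def)

lemma finite_regs: "finite regs" and finite_feats: "finite feats"
  unfolding regs_def feats_def using finite_exs by auto

abbreviation "reg_span \<equiv> span_of regs reg_val"
abbreviation "feat_span \<equiv> span_of feats feat_val"

lemma linear_mult_linear:
  assumes "f \<in> reg_span" "g \<in> reg_span"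
  shows "(\<lambda>s. f s * g s) \<in> feat_span"
proof -
  from assms obtain a b where ab: "\<And>s. f s = (\<Sum>i\<in>regs. reg_val s i * a i)" "\<And>s. g s = (\<Sum>i\<in>regs. reg_val s i * b i)"
    unfolding span_of_def by blast
  have "(\<lambda>s. f s * g s) = (\<lambda>s. \<Sum>i\<in>regs. \<Sum>j\<in>regs. feat_val s (Prod i j) * (a i * b j))"
    unfolding ab sum_product by (simp add: mult_ac)
  also have "\<dots> \<in> feat_span"
    by (intro span_of_sum span_of_cmult span_of_base finite_feats) (auto simp: feats_def)
  finally show ?thesis .
qed

lemma linear_reg: "i \<in> regs \<Longrightarrow> (\<lambda>s. reg_val s i) \<in> reg_span"
  by (rule span_of_base[OF finite_regs])

lemma linear_defect: "e \<in> exs \<Longrightarrow> defect e \<in> reg_span"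
  by (cases e)
     (auto simp: defect.simps[abs_def]
       intro!: span_of_zero span_of_diff span_of_cmult linear_reg dest: exs_closed exs_closed(1)[OF exs_closed(2)])

lemma quadratic_guard: "P \<in> exs \<Longrightarrow> guard P \<in> feat_span"
  unfolding guard_def[abs_def]
  by (intro span_of_add span_of_sum linear_mult_linear linear_defect span_of_diff linear_reg) auto

lemma linear_reg_act:
  assumes "d \<in> letters" "i \<in> regs"
  shows "(\<lambda>s. reg_val (act d s) i) \<in> reg_span"
proof (cases d)
  case (Inc e)
  with assms have e: "Reg e \<in> regs" "Tri e \<in> regs" "One \<in> regs"
    by (auto simp: letters_def)
  show ?thesis
  proof (cases "i = Reg e \<or> i = Tri e")
    case False
    then have "(\<lambda>s. reg_val (act d s) i) = (\<lambda>s. reg_val s i)"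
      by (cases i) (auto simp: Inc fun_eq_iff)
    then show ?thesis using linear_reg assms by simp
  next
    case True
    moreover have "(\<lambda>s. reg_val (act d s) (Reg e)) = (\<lambda>s. reg_val s (Reg e) + reg_val s One)"
      by (auto simp: Inc fun_eq_iff)
    \<comment> \<open>The recursion \<open>triangle (Suc m) = triangle m + Suc m\<close> is linear
      in the registers kept, so the triangular numbers can be updated.\<close>
    moreover have "(\<lambda>s. reg_val (act d s) (Tri e)) = (\<lambda>s. reg_val s (Tri e) + (reg_val s (Reg e) + reg_val s One))"
      by (auto simp: Inc fun_eq_iff)
    ultimately show ?thesis
      using e by (auto intro!: span_of_add linear_reg)
  qed
next
  case (Fire P Q)
  with assms have "Q \<in> exs"
    using rule_in_exs by (auto simp: letters_def)
  moreover have "(\<lambda>s. reg_val (act d s) i) =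
    (case i of One \<Rightarrow> \<lambda>s. reg_val s One | Config \<Rightarrow> \<lambda>s. reg_val s (Reg Q) | _ \<Rightarrow> \<lambda>s. 0)"
    by (cases i) (auto simp: Fire fun_eq_iff)
  ultimately show ?thesis
    by (cases i) (auto intro: span_of_zero linear_reg)
qed

text \<open>Registers change linearly, so products of two registers become combinations of such
  products; the penalty grows by a guard that is quadratic in the registers.\<close>

lemma quadratic_feat_act:
  assumes "d \<in> letters" "l \<in> feats"
  shows "(\<lambda>s. feat_val (act d s) l) \<in> feat_span"
proof (cases l)
  case (Prod i j)
  then have "i \<in> regs" "j \<in> regs" using assms(2) by (auto simp: feats_def)
  then show ?thesis
    using linear_mult_linear linear_reg_act assms(1) by (simp add: Prod)
next
  case Penalty
  have base: "(\<lambda>s. feat_val s Penalty) \<in> feat_span"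
    by (intro span_of_base finite_feats) (simp add: feats_def)
  show ?thesis
  proof (cases d)
    case (Inc e)
    then have "(\<lambda>s. feat_val (act d s) l) = (\<lambda>s. feat_val s Penalty)"
      by (auto simp: Penalty fun_eq_iff)
    then show ?thesis using base by simp
  next
    case (Fire P Q)
    then have "P \<in> exs" using assms(1) rule_in_exs by (auto simp: letters_def)
    moreover have "(\<lambda>s. feat_val (act d s) l) = (\<lambda>s. feat_val s Penalty + guard P s)"
      by (auto simp: Penalty Fire fun_eq_iff)
    ultimately show ?thesis using base quadratic_guard by (auto intro: span_of_add)
  qed
qed

definition score :: "store \<Rightarrow> int" where
  "score s = feat_val s (Prod One One) - feat_val s Penalty - feat_val s (Prod Config Config)"

lemma quadratic_score: "score \<in> feat_span"
  unfolding score_def[abs_def]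
  by (intro span_of_diff span_of_base finite_feats) (auto simp: feats_def)

text \<open>The score is 1 minus the penalty minus the squared configuration. For nonnegative
  integers it is positive only if both are 0.\<close>

lemma score_pos_iff:
  "(\<exists>u. set u \<subseteq> letters \<and> score (run u (0, n, \<lambda>_. 0)) > 0) \<longleftrightarrow> (step (set R))\<^sup>*\<^sup>* n 0"
proof
  assume "\<exists>u. set u \<subseteq> letters \<and> score (run u (0, n, \<lambda>_. 0)) > 0"
  then obtain u p c r where u: "set u \<subseteq> letters" "run u (0, n, \<lambda>_. 0) = (p, c, r)" "score (p, c, r) > 0"
    by (metis prod_cases3)
  have "p \<ge> 0" "p = 0 \<longrightarrow> (step (set R))\<^sup>*\<^sup>* n c"
    using run_sound[OF u(1,2)] by auto
  moreover have "p + int c * int c < 1" using u(3) by (simp add: score_def)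
  ultimately have "p = 0" "int c * int c = 0"
    using zero_le_square[of "int c"] by linarith+
  then show "(step (set R))\<^sup>*\<^sup>* n 0" using \<open>p = 0 \<longrightarrow> _\<close> by simp
next
  assume "(step (set R))\<^sup>*\<^sup>* n 0"
  from run_complete[OF this] show "\<exists>u. set u \<subseteq> letters \<and> score (run u (0, n, \<lambda>_. 0)) > 0"
    by (force simp: score_def)
qed

theorem steps_reduce_to_growth:
  assumes "k \<ge> 2" "\<rat> \<subseteq> S" "R \<noteq> []"
  shows "\<exists>L. (\<forall>n. valid_linrep k S (L n)) \<and> recursive (\<lambda>n. enc_linrep (L n)) \<and>
     (\<forall>n. has_poly_growth (linrep_seq k (L n)) \<longleftrightarrow> (step (set R))\<^sup>*\<^sup>* n 0)"
proof -
  have "finite letters" unfolding letters_def using finite_exs by simp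
  then obtain ls where ls: "set ls = letters" using finite_list by blast
  have "letters \<noteq> {}" using assms(3) unfolding letters_def by simp
  then have t: "length ls > 0" using ls by auto
  have "\<forall>d l. \<exists>c. d \<in> letters \<longrightarrow> l \<in> feats \<longrightarrow> (\<forall>s. feat_val (act d s) l = (\<Sum>j\<in>feats. feat_val s j * c j))"
    using quadratic_feat_act unfolding span_of_def by blast
  then obtain A where A: "\<And>d l s. d \<in> letters \<Longrightarrow> l \<in> feats \<Longrightarrow>
      feat_val (act d s) l = (\<Sum>j\<in>feats. feat_val s j * A d l j)"
    by metis
  obtain \<tau> where \<tau>: "\<And>s. score s = (\<Sum>j\<in>feats. feat_val s j * \<tau> j)"
    using quadratic_score unfolding span_of_def by blast
  \<comment> \<open>In the start store only \<open>One\<close> and \<open>Config\<close> are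
    nonzero, so all features are 0, 1, \<open>n\<close> or \<open>n * n\<close>.\<close>
  have init: "(\<lambda>n. feat_val (0, n, \<lambda>_. 0) l) \<in> {\<lambda>_. 0, \<lambda>_. 1, int, \<lambda>n. int n * int n}" for l
  proof (cases l)
    case (Prod i j)
    then show ?thesis by (cases i; cases j) auto
  qed simp
  \<comment> \<open>Letters are numbered by positions in \<open>ls\<close>; this passes from words
    of positions to words of letters.\<close>
  have words: "(\<exists>u. set u \<subseteq> {..<length ls} \<and> Q (map ((!) ls) u)) \<longleftrightarrow> (\<exists>u. set u \<subseteq> letters \<and> Q u)" for Q
  proof -
    have "letters = (!) ls ` {..<length ls}"
      by (auto simp: in_set_conv_nth simp flip: ls)
    then have "lists letters = map ((!) ls) ` lists {..<length ls}"
      by (simp add: lists_image)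
    then have "(\<exists>v\<in>lists letters. Q v) \<longleftrightarrow> (\<exists>u\<in>lists {..<length ls}. Q (map ((!) ls) u))"
      by auto
    then show ?thesis by (simp add: lists_eq_set)
  qed
  have fold: "foldl (\<lambda>s d. act (ls ! d) s) s u = run (map ((!) ls) u) s" for s u
    by (simp add: run_def foldl_map)
  have "feat_val (act (ls ! d) s) l = (\<Sum>j\<in>feats. feat_val s j * A (ls ! d) l j)"
    if "d < length ls" "l \<in> feats" for d l s
    using A that ls nth_mem by blast
  from letter_system_reduction[where \<tau> = \<tau> and init = "\<lambda>n. (0, n, \<lambda>_. 0)"
      and act = "\<lambda>d. act (ls ! d)" and A = "\<lambda>d j l. A (ls ! d) l j" and \<phi> = feat_val,
      OF assms(1,2) t finite_feats this init]
  show ?thesis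
    unfolding fold \<tau>[symmetric] words[of "\<lambda>u. score (run u (0, _, \<lambda>_. 0)) > 0"] score_pos_iff .
qed

end

section \<open>Undecidability of polynomial growth\<close>

theorem theorem3p10:
  fixes k :: nat and S :: "real set"
  assumes "k \<ge> 2"
    and "is_subring S"
    and "\<rat> \<subseteq> S"
    and "\<forall>x\<in>S. algebraic x"
  shows "\<not> (\<exists>g. \<forall>L. valid_linrep k S L \<longrightarrow>
            eval g [enc_linrep L] (if has_poly_growth (linrep_seq k L) then 1 else 0))"
proof
  assume "\<exists>g. \<forall>L. valid_linrep k S L \<longrightarrow>
            eval g [enc_linrep L] (if has_poly_growth (linrep_seq k L) then 1 else 0)"
  then obtain g where g: "\<And>L. valid_linrep k S L \<Longrightarrow>
            eval g [enc_linrep L] (if has_poly_growth (linrep_seq k L) then 1 else 0)"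
    by blast
  interpret rule_system recf_rules .
  have "recf_rules \<noteq> []" by (simp add: recf_rules_def Let_def)
  from steps_reduce_to_growth[OF assms(1,3) this] obtain L where L:
    "\<And>n. valid_linrep k S (L n)" "recursive (\<lambda>n. enc_linrep (L n))"
    "\<And>n. has_poly_growth (linrep_seq k (L n)) \<longleftrightarrow> recf_step\<^sup>*\<^sup>* n 0"
    by blast
  from L(2) obtain h where h: "\<And>n. eval h [n] (enc_linrep (L n))"
    unfolding recursive_def by blast
  \<comment> \<open>The decider \<open>g\<close> is only known to be correct on valid
    representations; the reduction yields no others, so the composition is total.\<close>
  have "eval (Comp g [h]) [n] (if recf_step\<^sup>*\<^sup>* n 0 then 1 else 0)" for n
    using eval_Comp1[OF h g[OF L(1)]] by (simp add: L(3))
  then have "recursive (\<lambda>n. if recf_step\<^sup>*\<^sup>* n 0 then 1 else 0)"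
    unfolding recursive_def by blast
  from steps_undecidable[OF this] show False by simp
qed

end
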